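(* Suppose $G$ is an amenable group, and $\mathbf F=(F_k)_{k=1}^\infty$ is a tempered Følner sequence for $G$. Let $f\in C_{\mathbb R}(X)$, and let $\mathcal K$ be a nonempty compact subset of the compact interval $[\underline a(f),\overline a(f)]$. Let $\mu$ be a fully supported Borel probability measure on $X$ that neglects shells. Then there exist points $x,y\in X$ and sequences $(r_k)_{k=1}^\infty,(s_k)_{k=1}^\infty$ of positive numbers such that $$\mathcal K=\operatorname{LS}\left(\left(\alpha_{B(x,y;r_k,s_k)}\left(\operatorname{Avg}_{F_k}f\right)\right)_{k=1}^\infty\right).$$
   Context: $(X,\rho)$ is a compact metric space, $C_{\mathbb R}(X)$ is the space of real-valued continuous functions on $X$, $G$ is a discrete group, and $T:G\curvearrowright X$ is a left action by homeomorphisms $(T_g)_{g\in G}$ ($T_{g_1}\circ T_{g_2}=T_{g_1g_2}$, $T_{1_G}=\mathrm{id}_X$). $\operatorname{Avg}_Ff:=\frac1{|F|}\sum_{g\in F}f\circ T_g$. A sequence $(F_k)_{k=1}^\infty$ of nonempty finite subsets of $G$ is Følner if $\lim_{k\to\infty}|F_k\Delta gF_k|/|F_k|=0$ for all $g\in G$; it is tempered if there is $c>0$ with $\left|\bigcup_{j=1}^{k-1}F_j^{-1}F_k\right|\le c|F_k|$ for all $k\ge2$. $\mathcal M_T(X)$ is the set of $T$-invariant Borel probability measures on $X$; $\overline a(f)=\sup\{\int f\,\mathrm d\nu:\nu\in\mathcal M_T(X)\}$, $\underline a(f)=\inf\{\int f\,\mathrm d\nu:\nu\in\mathcal M_T(X)\}$.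 For $r,s>0$, $B(x;r)=\{z\in X:\rho(x,z)<r\}$ and $B(x,y;r,s)=B(x;r)\cup B(y;s)$. For a measurable $E\subseteq X$ with $\mu(E)>0$, $\alpha_E(f):=\frac1{\mu(E)}\int_Ef\,\mathrm d\mu$. $\mu$ neglects shells if $\mu(\{y\in X:\rho(x,y)=r\})=0$ for all $x\in X$, $r\in[0,\infty)$. For a sequence $(z_k)_{k=1}^\infty$ in a topological space, $\operatorname{LS}((z_k)_{k=1}^\infty)$ is the set of all limits of convergent subsequences. *)

theory Defs
  imports "HOL-Probability.Probability" "HOL-Algebra.Group_Action"
begin

(* The space X is a type of class metric_space; compactness is stated as compact UNIV.
   A group is a HOL-Algebra structure G. Sequences indexed by k = 1, 2, ... are functions
   on nat shifted by one: the k-th term is F (k - 1). *)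

definition homeo_action :: "('g, 'm) monoid_scheme \<Rightarrow> ('g \<Rightarrow> 'a::topological_space \<Rightarrow> 'a) \<Rightarrow> bool"
  where "homeo_action G T \<longleftrightarrow>
    group_action G UNIV T \<and> (\<forall>g\<in>carrier G. \<exists>S. homeomorphism UNIV UNIV (T g) S)"

lemma homeo_action_iff:
  "homeo_action G T \<longleftrightarrow>
     group G \<and>
     (\<forall>g\<in>carrier G. \<exists>S. homeomorphism UNIV UNIV (T g) S) \<and>
     (\<forall>g\<in>carrier G. \<forall>h\<in>carrier G. T g \<circ> T h = T (g \<otimes>\<^bsub>G\<^esub> h)) \<and>
     T \<one>\<^bsub>G\<^esub> = id"
proof
  assume a: "homeo_action G T"
  then interpret group_action G UNIV T
    by (simp add: homeo_action_def)
  have "group G" using group_hom by (rule group_hom.axioms(1))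
  have "T \<one>\<^bsub>G\<^esub> = id"
    unfolding id_eq_one[symmetric] by (rule ext) simp
  moreover have "T g \<circ> T h = T (g \<otimes>\<^bsub>G\<^esub> h)" if "g \<in> carrier G" "h \<in> carrier G" for g h
    by (rule ext) (simp only: composition_rule[OF UNIV_I that] o_apply)
  ultimately show "group G \<and>
     (\<forall>g\<in>carrier G. \<exists>S. homeomorphism UNIV UNIV (T g) S) \<and>
     (\<forall>g\<in>carrier G. \<forall>h\<in>carrier G. T g \<circ> T h = T (g \<otimes>\<^bsub>G\<^esub> h)) \<and>
     T \<one>\<^bsub>G\<^esub> = id"
    using a \<open>group G\<close> unfolding homeo_action_def by blast
next
  assume a: "group G \<and>
     (\<forall>g\<in>carrier G. \<exists>S. homeomorphism UNIV UNIV (T g) S) \<and>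
     (\<forall>g\<in>carrier G. \<forall>h\<in>carrier G. T g \<circ> T h = T (g \<otimes>\<^bsub>G\<^esub> h)) \<and>
     T \<one>\<^bsub>G\<^esub> = id"
  note grp = conjunct1[OF a] and homeo = conjunct1[OF conjunct2[OF a]]
    and comp = conjunct1[OF conjunct2[OF conjunct2[OF a]]]
  have bij: "T g \<in> Bij UNIV" if g: "g \<in> carrier G" for g
  proof -
    obtain S where S: "homeomorphism UNIV UNIV (T g) S"
      using bspec[OF homeo g] by (rule exE)
    have "T g (S y) = y" "S (T g y) = y" for y
      using S by (simp_all add: homeomorphism_def)
    then have "bij (T g)" by (intro o_bij[of S]) (simp_all add: fun_eq_iff)
    then show ?thesis by (simp add: Bij_def)
  qed
  have "T (g \<otimes>\<^bsub>G\<^esub> h) = T g \<otimes>\<^bsub>BijGroup UNIV\<^esub> T h" if "g \<in> carrier G" "h \<in> carrier G" for g h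
  proof -
    have "T (g \<otimes>\<^bsub>G\<^esub> h) = T g \<circ> T h" by (rule bspec[OF bspec[OF comp that(1)] that(2), symmetric])
    then show ?thesis
      using bij[OF that(1)] bij[OF that(2)] by (simp add: BijGroup_def compose_def comp_def restrict_def)
  qed
  moreover have "T \<in> carrier G \<rightarrow> carrier (BijGroup UNIV)"
    using bij by (simp add: BijGroup_def)
  ultimately have "T \<in> hom G (BijGroup UNIV)" by (simp add: hom_def)
  then have "group_action G UNIV T"
    using grp by (simp add: group_action_def group_hom_def group_hom_axioms_def group_BijGroup)
  then show "homeo_action G T"
    unfolding homeo_action_def using homeo by (rule conjI)
qed

(* Invariant mean: a left-invariant finitely additive probability measure on all subsets of G. *)
definition amenable :: "('g, 'm) monoid_scheme \<Rightarrow> bool"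
  where "amenable G \<longleftrightarrow> group G \<and>
    (\<exists>m :: 'g set \<Rightarrow> real.
        (\<forall>A. A \<subseteq> carrier G \<longrightarrow> 0 \<le> m A) \<and>
        m (carrier G) = 1 \<and>
        (\<forall>A B. A \<subseteq> carrier G \<longrightarrow> B \<subseteq> carrier G \<longrightarrow> A \<inter> B = {} \<longrightarrow> m (A \<union> B) = m A + m B) \<and>
        (\<forall>g\<in>carrier G. \<forall>A. A \<subseteq> carrier G \<longrightarrow> m (g <#\<^bsub>G\<^esub> A) = m A))"

definition folner_seq :: "('g, 'm) monoid_scheme \<Rightarrow> (nat \<Rightarrow> 'g set) \<Rightarrow> bool"
  where "folner_seq G F \<longleftrightarrow>
    (\<forall>k. F k \<subseteq> carrier G \<and> finite (F k) \<and> F k \<noteq> {}) \<and>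
    (\<forall>g\<in>carrier G.
      (\<lambda>k. real (card (sym_diff (F k) (g <#\<^bsub>G\<^esub> F k))) / real (card (F k))) \<longlonglongrightarrow> 0)"

definition tempered :: "('g, 'm) monoid_scheme \<Rightarrow> (nat \<Rightarrow> 'g set) \<Rightarrow> bool"
  where "tempered G F \<longleftrightarrow>
    (\<exists>c::real. c > 0 \<and> (\<forall>k\<ge>1.
      real (card (\<Union>j<k. (set_inv\<^bsub>G\<^esub> (F j)) <#>\<^bsub>G\<^esub> (F k))) \<le> c * real (card (F k))))"

definition Avg :: "('g \<Rightarrow> 'a \<Rightarrow> 'a) \<Rightarrow> 'g set \<Rightarrow> ('a \<Rightarrow> real) \<Rightarrow> 'a \<Rightarrow> real"
  where "Avg T F f = (\<lambda>x. (\<Sum>g\<in>F. (f \<circ> T g) x) / real (card F))"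

definition borel_prob :: "'a::topological_space measure \<Rightarrow> bool"
  where "borel_prob \<mu> \<longleftrightarrow> prob_space \<mu> \<and> sets \<mu> = sets borel"

definition inv_measures ::
    "('g, 'm) monoid_scheme \<Rightarrow> ('g \<Rightarrow> 'a::topological_space \<Rightarrow> 'a) \<Rightarrow> 'a measure set"
  where "inv_measures G T = {\<nu>. borel_prob \<nu> \<and> (\<forall>g\<in>carrier G. distr \<nu> borel (T g) = \<nu>)}"

definition upper_a ::
    "('g, 'm) monoid_scheme \<Rightarrow> ('g \<Rightarrow> 'a::topological_space \<Rightarrow> 'a) \<Rightarrow> ('a \<Rightarrow> real) \<Rightarrow> real"
  where "upper_a G T f = (SUP \<nu>\<in>inv_measures G T. \<integral>x. f x \<partial>\<nu>)"

definition lower_a ::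
    "('g, 'm) monoid_scheme \<Rightarrow> ('g \<Rightarrow> 'a::topological_space \<Rightarrow> 'a) \<Rightarrow> ('a \<Rightarrow> real) \<Rightarrow> real"
  where "lower_a G T f = (INF \<nu>\<in>inv_measures G T. \<integral>x. f x \<partial>\<nu>)"

definition ball2 :: "'a::metric_space \<Rightarrow> 'a \<Rightarrow> real \<Rightarrow> real \<Rightarrow> 'a set"
  where "ball2 x y r s = ball x r \<union> ball y s"

definition set_avg :: "'a measure \<Rightarrow> 'a set \<Rightarrow> ('a \<Rightarrow> real) \<Rightarrow> real"
  where "set_avg \<mu> E f = (LINT x:E|\<mu>. f x) / measure \<mu> E"

definition fully_supported :: "'a::topological_space measure \<Rightarrow> bool"
  where "fully_supported \<mu> \<longleftrightarrow> (\<forall>U. open U \<longrightarrow> U \<noteq> {} \<longrightarrow> emeasure \<mu> U > 0)"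

definition neglects_shells :: "'a::metric_space measure \<Rightarrow> bool"
  where "neglects_shells \<mu> \<longleftrightarrow> (\<forall>x. \<forall>r\<ge>0. emeasure \<mu> {y. dist x y = r} = 0)"

definition LS :: "(nat \<Rightarrow> 'b::topological_space) \<Rightarrow> 'b set"
  where "LS z = {l. \<exists>\<sigma>::nat \<Rightarrow> nat. strict_mono \<sigma> \<and> (z \<circ> \<sigma>) \<longlonglongrightarrow> l}"

end

theory Submission
  imports Defs
begin

text \<open>
  Let \<open>\<beta>\<close> be the infimum over \<open>n\<close> of the maximum of the \<open>n\<close>-th temporal average of \<open>f\<close>. Invariance
  bounds all integrals of \<open>f\<close> by \<open>\<beta>\<close>, so it suffices to find one point \<open>x\<close> whose averages have lower
  limit at least \<open>\<beta>\<close>; no pointwise ergodic theorem is needed. Pick averages whose maxima are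
  extremely close to \<open>\<beta>\<close>. The deficiencies \<open>\<psi>\<^sub>i \<ge> 0\<close> of these averages from their maxima have tiny
  mean along the orbit of a point maximising a late average. A weak-type maximal inequality, counted
  on the orbit, leaves orbit points at which all averages of all \<open>\<psi>\<^sub>i\<close> are small, and compactness
  gives a single point \<open>x\<close>. Applied to \<open>-f\<close> this gives \<open>y\<close>. For fixed \<open>k\<close> the spatial average over
  \<open>B(x,y;r,s)\<close> is continuous in \<open>(r,s)\<close> and comes arbitrarily close to the values of the temporal
  average at \<open>x\<close> and at \<open>y\<close>, so it can be steered close to any prescribed number in between. The
  prescribed numbers run through a dense subset of \<open>K\<close>, each infinitely often.

  The maximal inequality rests on a deterministic fractional covering: going from the largest index
  down, a translate of \<open>F\<^sub>k\<close> is selected with weight \<open>1/|F\<^sub>k|\<close> unless the weights selected so far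
  already sum to \<open>1\<close> at one of its points. The total weight never exceeds \<open>2\<close> anywhere, and
  temperedness bounds the number of rejected translates by a multiple of the number of selected ones.
\<close>

section \<open>Invariant measures\<close>

text \<open>The usual regularisation of a content: closed sets approximate open sets from inside,
  then \<open>outer_content\<close> approximates all sets by open ones from outside. Values in
  \<open>ennreal\<close> spare boundedness checks for suprema and infima.\<close>

definition inner_content :: "('a::topological_space set \<Rightarrow> real) \<Rightarrow> 'a set \<Rightarrow> ennreal"
  where "inner_content \<kappa> U = (SUP C\<in>{C. closed C \<and> C \<subseteq> U}. ennreal (\<kappa> C))"

definition outer_content :: "('a::topological_space set \<Rightarrow> real) \<Rightarrow> 'a set \<Rightarrow> ennreal"
  where "outer_content \<kappa> A = (INF U\<in>{U. open U \<and> A \<subseteq> U}. inner_content \<kappa> U)"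

text \<open>Additivity on all subsets is what the image of an invariant mean provides, so no domain
  of measurable sets is attached.\<close>

locale prob_content =
  fixes \<kappa> :: "'a::metric_space set \<Rightarrow> real"
  assumes compact_space: "compact (UNIV :: 'a set)"
    and nonneg: "0 \<le> \<kappa> A"
    and total: "\<kappa> UNIV = 1"
    and additive: "A \<inter> B = {} \<Longrightarrow> \<kappa> (A \<union> B) = \<kappa> A + \<kappa> B"
begin

lemma content_empty: "\<kappa> {} = 0"
  using additive[of "{}" "{}"] by simp

lemma content_mono: "A \<subseteq> B \<Longrightarrow> \<kappa> A \<le> \<kappa> B"
  using additive[of A "B - A"] nonneg[of "B - A"] by (simp add: Un_absorb1)

lemma content_subadd: "\<kappa> (A \<union> B) \<le> \<kappa> A + \<kappa> B"
  using additive[of A "B - A"] content_mono[of "B - A" B] by simp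

lemma content_UN_le:
  assumes "finite I"
  shows "\<kappa> (\<Union>i\<in>I. A i) \<le> (\<Sum>i\<in>I. \<kappa> (A i))"
  using assms
proof (induction I)
  case empty
  then show ?case by (simp add: content_empty)
next
  case (insert i I)
  then show ?case using content_subadd[of "A i" "\<Union>i\<in>I. A i"] by simp
qed

section \<open>Regularisation of the content and its countable subadditivity\<close>

lemma inner_content_upper: "closed C \<Longrightarrow> C \<subseteq> U \<Longrightarrow> ennreal (\<kappa> C) \<le> inner_content \<kappa> U"
  unfolding inner_content_def by (rule SUP_upper) simp

lemma inner_content_mono: "U \<subseteq> V \<Longrightarrow> inner_content \<kappa> U \<le> inner_content \<kappa> V"
  unfolding inner_content_def by (rule SUP_subset_mono) auto

text \<open>A closed subset of the union is compact, hence covered by finitely many balls, each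
  inside one \<open>U i\<close> even when closed. Collecting the closed balls by index yields closed
  pieces to which finite subadditivity applies.\<close>

lemma inner_content_UN_le:
  fixes U :: "nat \<Rightarrow> 'a set"
  assumes op: "\<And>i. open (U i)"
  shows "inner_content \<kappa> (\<Union>i. U i) \<le> (\<Sum>i. inner_content \<kappa> (U i))"
  unfolding inner_content_def[of _ "\<Union>i. U i"]
proof (rule SUP_least)
  fix C assume "C \<in> {C. closed C \<and> C \<subseteq> (\<Union>i. U i)}"
  then have C: "closed C" "C \<subseteq> (\<Union>i. U i)" by auto
  have "\<exists>i r. 0 < r \<and> cball x r \<subseteq> U i" if "x \<in> C" for x
  proof -
    from that C(2) obtain i where "x \<in> U i" by blast
    with op[of i] show ?thesis unfolding open_contains_cball by blast
  qed
  then obtain ix rx where ir: "\<And>x. x \<in> C \<Longrightarrow> 0 < rx x" "\<And>x. x \<in> C \<Longrightarrow> cball x (rx x) \<subseteq> U (ix x)"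
    by metis
  have "compact C" using C(1) compact_space closed_Int_compact[of C UNIV] by simp
  moreover have "C \<subseteq> (\<Union>x\<in>C. ball x (rx x))" using ir(1) by auto
  ultimately obtain D where D: "D \<subseteq> C" "finite D" "C \<subseteq> (\<Union>x\<in>D. ball x (rx x))"
    using compactE_image[of C C "\<lambda>x. ball x (rx x)", OF _ open_ball] by blast
  define P where "P i = (\<Union>x\<in>{x\<in>D. ix x = i}. cball x (rx x))" for i
  have P: "closed (P i)" "P i \<subseteq> U i" for i
    using D(1,2) ir(2) by (auto simp: P_def subset_iff intro!: closed_UN)
  have "C \<subseteq> (\<Union>i\<in>ix ` D. P i)"
    using D(3) by (fastforce simp: P_def)
  then have "\<kappa> C \<le> (\<Sum>i\<in>ix ` D. \<kappa> (P i))"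
    by (intro order_trans[OF content_mono content_UN_le]) (use D(2) in auto)
  then have "ennreal (\<kappa> C) \<le> (\<Sum>i\<in>ix ` D. ennreal (\<kappa> (P i)))"
    by (simp add: nonneg sum_ennreal ennreal_leI)
  also have "\<dots> \<le> (\<Sum>i\<in>ix ` D. inner_content \<kappa> (U i))"
    by (intro sum_mono inner_content_upper P)
  also have "\<dots> \<le> (\<Sum>i. inner_content \<kappa> (U i))"
    by (intro sum_le_suminf) (use D(2) in auto)
  finally show "ennreal (\<kappa> C) \<le> (\<Sum>i. inner_content \<kappa> (U i))" .
qed

lemma outer_content_open: "open U \<Longrightarrow> outer_content \<kappa> U = inner_content \<kappa> U"
  unfolding outer_content_def by (intro antisym INF_lower INF_greatest) (auto intro: inner_content_mono)

lemma outer_content_mono: "A \<subseteq> B \<Longrightarrow> outer_content \<kappa> A \<le> outer_content \<kappa> B"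
  unfolding outer_content_def by (rule INF_superset_mono) auto

lemma outer_content_le: "open U \<Longrightarrow> A \<subseteq> U \<Longrightarrow> outer_content \<kappa> A \<le> inner_content \<kappa> U"
  unfolding outer_content_def by (rule INF_lower) simp

lemma inner_content_UNIV: "inner_content \<kappa> UNIV = 1"
proof (rule antisym)
  show "inner_content \<kappa> UNIV \<le> 1"
    unfolding inner_content_def using content_mono[of _ UNIV] total
    by (intro SUP_least) (auto simp: ennreal_le_1)
  show "1 \<le> inner_content \<kappa> UNIV"
    using inner_content_upper[of UNIV UNIV] total by simp
qed

lemma inner_content_empty: "inner_content \<kappa> {} = 0"
  unfolding inner_content_def by (simp add: content_empty Collect_conv_if)

lemma outer_content_countably_subadditive:
  fixes A :: "nat \<Rightarrow> 'a set"
  shows "outer_content \<kappa> (\<Union>i. A i) \<le> (\<Sum>i. outer_content \<kappa> (A i))"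
proof (rule ennreal_le_epsilon)
  fix e :: real assume e: "0 < e"
  have fin: "outer_content \<kappa> B < \<top>" for B
    using outer_content_le[of UNIV B] inner_content_UNIV by (simp add: le_less_trans)
  \<comment> \<open>The slack sums to \<open>e\<close> over all \<open>i\<close>. Finiteness of
    \<open>outer_content\<close> makes adding it a strict increase, so some open set lies below the
    enlarged value.\<close>
  have "\<exists>U. open U \<and> A i \<subseteq> U \<and> inner_content \<kappa> U \<le> outer_content \<kappa> (A i) + ennreal (e * (1/2)^Suc i)" for i
  proof -
    have "0 < ennreal (e * (1/2)^Suc i)" using e by simp
    then have "outer_content \<kappa> (A i) < outer_content \<kappa> (A i) + ennreal (e * (1/2)^Suc i)"
      using ennreal_add_left_cancel_less[of "outer_content \<kappa> (A i)" 0] fin[of "A i"] by (metis add.right_neutral less_irrefl infinity_ennreal_def)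
    then obtain U where "U \<in> {U. open U \<and> A i \<subseteq> U}"
      "inner_content \<kappa> U < outer_content \<kappa> (A i) + ennreal (e * (1/2)^Suc i)"
      unfolding outer_content_def[of _ "A i"] INF_less_iff by blast
    then show ?thesis by (blast intro: less_imp_le)
  qed
  then obtain U where U: "\<And>i. open (U i)" "\<And>i. A i \<subseteq> U i"
    "\<And>i. inner_content \<kappa> (U i) \<le> outer_content \<kappa> (A i) + ennreal (e * (1/2)^Suc i)"
    by metis
  have "outer_content \<kappa> (\<Union>i. A i) \<le> inner_content \<kappa> (\<Union>i. U i)"
    using U by (intro outer_content_le open_UN UN_mono) auto
  also have "\<dots> \<le> (\<Sum>i. inner_content \<kappa> (U i))" by (rule inner_content_UN_le[OF U(1)])
  also have "\<dots> \<le> (\<Sum>i. outer_content \<kappa> (A i) + ennreal (e * (1/2)^Suc i))"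
    by (intro suminf_le U(3)) auto
  also have "\<dots> = (\<Sum>i. outer_content \<kappa> (A i)) + (\<Sum>i. ennreal (e * (1/2)^Suc i))"
    by (rule suminf_add[symmetric]) auto
  also have "(\<Sum>i. ennreal (e * (1/2)^Suc i)) = ennreal e"
    using sums_mult[OF power_half_series, of e] e by (intro suminf_ennreal_eq) auto
  finally show "outer_content \<kappa> (\<Union>i. A i) \<le> (\<Sum>i. outer_content \<kappa> (A i)) + ennreal e" .
qed

lemma outer_measure_space_outer_content: "outer_measure_space (Pow UNIV) (outer_content \<kappa>)"
  unfolding outer_measure_space_def positive_def increasing_def countably_subadditive_def
  using outer_content_mono outer_content_countably_subadditive
  by (auto simp: outer_content_open inner_content_empty)

text \<open>A closed \<open>C\<close> inside \<open>U \<inter> V\<close> leaves the open set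
  \<open>V - C\<close>, which contains \<open>V - U\<close>. Closed subsets of \<open>V - C\<close>
  are disjoint from \<open>C\<close>, so additivity of \<open>\<kappa>\<close> bounds the
  sum.\<close>

lemma inner_content_split:
  assumes "open U" "open V"
  shows "inner_content \<kappa> (U \<inter> V) + outer_content \<kappa> (V - U) \<le> inner_content \<kappa> V"
proof -
  have *: "ennreal (\<kappa> C) + outer_content \<kappa> (V - U) \<le> inner_content \<kappa> V" if C: "closed C" "C \<subseteq> U \<inter> V" for C
  proof -
    have "ennreal (\<kappa> C) + ennreal (\<kappa> D) \<le> inner_content \<kappa> V" if D: "closed D" "D \<subseteq> V - C" for D
    proof -
      have "\<kappa> C + \<kappa> D = \<kappa> (C \<union> D)" using D by (subst additive) auto
      then show ?thesis
        using C D inner_content_upper[of "C \<union> D" V]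
        by (auto simp: nonneg simp flip: ennreal_plus)
    qed
    then have "ennreal (\<kappa> C) + inner_content \<kappa> (V - C) \<le> inner_content \<kappa> V"
      unfolding inner_content_def[of _ "V - C"]
      by (subst ennreal_SUP_add_right) (auto intro!: SUP_least)
    moreover have "outer_content \<kappa> (V - U) \<le> inner_content \<kappa> (V - C)"
      using C assms by (intro outer_content_le) (auto intro: open_Diff)
    ultimately show ?thesis by (meson add_left_mono order_trans)
  qed
  then show ?thesis
    unfolding inner_content_def[of _ "U \<inter> V"]
    by (subst ennreal_SUP_add_left[symmetric]) (auto intro!: SUP_least)
qed

text \<open>Caratheodory's criterion holds for open test sets by \<open>inner_content_split\<close>;
  arbitrary test sets follow by the infimum over open supersets.\<close>

lemma open_in_lambda_system:
  assumes "open U"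
  shows "U \<in> lambda_system UNIV (Pow UNIV) (outer_content \<kappa>)"
proof -
  have "outer_content \<kappa> (U \<inter> A) + outer_content \<kappa> ((UNIV - U) \<inter> A) \<le> outer_content \<kappa> A" for A
    unfolding outer_content_def[of _ A]
  proof (rule INF_greatest)
    fix V assume "V \<in> {V. open V \<and> A \<subseteq> V}"
    then have V: "open V" "A \<subseteq> V" by auto
    have "outer_content \<kappa> (U \<inter> A) \<le> inner_content \<kappa> (U \<inter> V)"
      using assms V by (intro outer_content_le) auto
    moreover have "outer_content \<kappa> ((UNIV - U) \<inter> A) \<le> outer_content \<kappa> (V - U)"
      using V by (intro outer_content_mono) auto
    ultimately show "outer_content \<kappa> (U \<inter> A) + outer_content \<kappa> ((UNIV - U) \<inter> A) \<le> inner_content \<kappa> V"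
      using inner_content_split[OF assms V(1)] by (meson add_mono order_trans)
  qed
  moreover have "outer_content \<kappa> A \<le> outer_content \<kappa> (U \<inter> A) + outer_content \<kappa> ((UNIV - U) \<inter> A)" for A
  proof -
    have sub: "subadditive (Pow UNIV) (outer_content \<kappa>)"
      by (rule ring_of_sets.countably_subadditive_subadditive[of UNIV])
        (use outer_measure_space_outer_content ring_of_sets_Pow[of UNIV] in
          \<open>simp_all add: outer_measure_space_def\<close>)
    have "A = (U \<inter> A) \<union> ((UNIV - U) \<inter> A)" by auto
    then show ?thesis
      using subadditiveD[OF sub, of "U \<inter> A" "(UNIV - U) \<inter> A"] by auto
  qed
  ultimately show ?thesis
    unfolding lambda_system_def by (auto intro!: antisym)
qed

section \<open>The Borel measure obtained from the content\<close>

definition borel_extension :: "'a measure"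
  where "borel_extension = measure_of UNIV (sets borel) (outer_content \<kappa>)"

lemma sets_borel_extension: "sets borel_extension = sets borel"
  unfolding borel_extension_def by (simp add: sets.sigma_sets_eq[of borel, simplified])

lemma emeasure_borel_extension:
  assumes "A \<in> sets borel"
  shows "emeasure borel_extension A = outer_content \<kappa> A"
proof -
  define L where "L = lambda_system UNIV (Pow UNIV) (outer_content \<kappa>)"
  have ms: "measure_space UNIV L (outer_content \<kappa>)"
    unfolding L_def
    by (rule sigma_algebra.caratheodory_lemma[OF sigma_algebra_Pow outer_measure_space_outer_content])
  then have sa: "sigma_algebra UNIV L" by (simp add: measure_space_def)
  have sub: "sets borel \<subseteq> L"
    unfolding sets_borel using open_in_lambda_system
    by (intro sigma_algebra.sigma_sets_subset[OF sa]) (auto simp: L_def)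
  show ?thesis
    unfolding borel_extension_def
  proof (rule emeasure_measure_of_sigma)
    show "sigma_algebra UNIV (sets borel :: 'a set set)"
      using sets.sigma_algebra_axioms[of "borel :: 'a measure"] by simp
    show "positive (sets borel) (outer_content \<kappa>)"
      using ms by (simp add: measure_space_def positive_def)
    show "countably_additive (sets borel) (outer_content \<kappa>)"
      using ms sub unfolding measure_space_def countably_additive_def by (meson order_trans subsetD)
  qed fact
qed

lemma borel_prob_extension: "borel_prob borel_extension"
  unfolding borel_prob_def
proof
  have "space borel_extension = UNIV"
    using sets_eq_imp_space_eq[OF sets_borel_extension] by simp
  then show "prob_space borel_extension"
    by (intro prob_spaceI)
      (simp add: emeasure_borel_extension outer_content_open inner_content_UNIV)
qed (rule sets_borel_extension)

text \<open>Preimage under \<open>h\<close> permutes the closed sets and the open sets, so the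
  supremum and the infimum are merely reindexed.\<close>

lemma outer_content_homeo:
  assumes S: "homeomorphism UNIV UNIV h S"
    and inv: "\<And>A. \<kappa> (h -` A) = \<kappa> A"
  shows "outer_content \<kappa> (h -` A) = outer_content \<kappa> A"
proof -
  have cont: "continuous_on UNIV h" "continuous_on UNIV S" and
    SS: "\<And>x. S (h x) = x" "\<And>x. h (S x) = x"
    using S by (auto simp: homeomorphism_def)
  have cl: "closed (h -` C)" "closed (S -` C)" if "closed C" for C
    using that cont by (auto simp: continuous_closed_vimage continuous_on_eq_continuous_at)
  have op: "open (h -` C)" "open (S -` C)" if "open C" for C
    using that cont by (auto simp: open_vimage)
  have hS: "h -` (S -` C) = C" "S -` (h -` C) = C" for C
    using SS by auto
  have inner: "inner_content \<kappa> (h -` U) = inner_content \<kappa> U" for U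
  proof -
    have "{C. closed C \<and> C \<subseteq> h -` U} = vimage h ` {C. closed C \<and> C \<subseteq> U}"
      (is "?L = ?R")
    proof
      show "?L \<subseteq> ?R"
      proof
        fix C assume "C \<in> ?L"
        then show "C \<in> ?R"
          using cl hS SS by (intro image_eqI[of _ _ "S -` C"]) auto
      qed
    qed (use cl in auto)
    then show ?thesis unfolding inner_content_def by (simp add: image_image inv)
  qed
  have "{U. open U \<and> h -` A \<subseteq> U} = vimage h ` {U. open U \<and> A \<subseteq> U}" (is "?L = ?R")
  proof
    show "?L \<subseteq> ?R"
    proof
      fix C assume "C \<in> ?L"
      then show "C \<in> ?R"
        using op hS SS by (intro image_eqI[of _ _ "S -` C"]) (auto, metis subsetD vimageI)
    qed
  qed (use op in auto)
  then show ?thesis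
    unfolding outer_content_def by (simp add: image_image inner)
qed

end

text \<open>An invariant mean on \<open>G\<close>, pushed to \<open>X\<close> along an orbit, is an invariant finitely additive
  content; its regularisation is countably additive because \<open>X\<close> is compact.\<close>

lemma inv_measures_nonempty:
  fixes T :: "'g \<Rightarrow> 'a::metric_space \<Rightarrow> 'a"
  assumes cpt: "compact (UNIV :: 'a set)" and act: "homeo_action G T" and am: "amenable G"
  shows "inv_measures G T \<noteq> {}"
proof -
  interpret group G using am by (simp add: amenable_def)
  have T: "\<exists>S. homeomorphism UNIV UNIV (T g) S" if "g \<in> carrier G" for g
    using act that by (simp add: homeo_action_iff)
  have comp: "T (g \<otimes>\<^bsub>G\<^esub> h) x = T g (T h x)" if "g \<in> carrier G" "h \<in> carrier G" for g h x
  proof -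
    have "T g \<circ> T h = T (g \<otimes>\<^bsub>G\<^esub> h)" using act that by (simp add: homeo_action_iff)
    then show ?thesis by (metis comp_apply)
  qed
  obtain m :: "'g set \<Rightarrow> real" where mean: "\<forall>A. A \<subseteq> carrier G \<longrightarrow> 0 \<le> m A" "m (carrier G) = 1"
    "\<forall>A B. A \<subseteq> carrier G \<longrightarrow> B \<subseteq> carrier G \<longrightarrow> A \<inter> B = {} \<longrightarrow> m (A \<union> B) = m A + m B"
    "\<forall>g\<in>carrier G. \<forall>A. A \<subseteq> carrier G \<longrightarrow> m (g <#\<^bsub>G\<^esub> A) = m A"
    using am unfolding amenable_def by (elim conjE exE) (rule that)
  note m = mean(1)[rule_format] mean(2) mean(3)[rule_format] mean(4)[rule_format]
  define x0 :: 'a where "x0 = undefined"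
  define \<kappa> where "\<kappa> A = m {g \<in> carrier G. T g x0 \<in> A}" for A
  interpret prob_content \<kappa>
  proof
    show "\<kappa> (A \<union> B) = \<kappa> A + \<kappa> B" if "A \<inter> B = {}" for A B
    proof -
      have "{g \<in> carrier G. T g x0 \<in> A \<union> B} = {g \<in> carrier G. T g x0 \<in> A} \<union> {g \<in> carrier G. T g x0 \<in> B}"
        by auto
      then show ?thesis unfolding \<kappa>_def using that by (simp only:) (rule m(3), auto)
    qed
  qed (use cpt m(1,2) in \<open>auto simp: \<kappa>_def\<close>)
  have inv: "\<kappa> (T h -` A) = \<kappa> A" if h: "h \<in> carrier G" for h A
  proof -
    \<comment> \<open>The times at which the orbit is in \<open>A\<close> are the left translate by
      \<open>h\<close> of those at which it is in the preimage of \<open>A\<close> under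
      \<open>T h\<close>; left invariance of the mean then makes \<open>\<kappa>\<close>
      invariant.\<close>
    have "{g \<in> carrier G. T g x0 \<in> A} = h <#\<^bsub>G\<^esub> {g \<in> carrier G. T g x0 \<in> T h -` A}" (is "?L = ?R")
    proof
      show "?L \<subseteq> ?R"
      proof
        fix g assume g: "g \<in> ?L"
        then have "h \<otimes>\<^bsub>G\<^esub> (inv\<^bsub>G\<^esub> h \<otimes>\<^bsub>G\<^esub> g) = g"
          using h by (simp add: m_assoc[symmetric])
        then show "g \<in> ?R" unfolding l_coset_def
          using g h comp[of h "inv\<^bsub>G\<^esub> h \<otimes>\<^bsub>G\<^esub> g" x0]
          by (intro UN_I[of "inv\<^bsub>G\<^esub> h \<otimes>\<^bsub>G\<^esub> g"]) auto
      qed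
      show "?R \<subseteq> ?L" using h by (auto simp: l_coset_def comp)
    qed
    then show ?thesis unfolding \<kappa>_def using m(4)[OF h] by auto
  qed
  have "distr borel_extension borel (T g) = borel_extension" if g: "g \<in> carrier G" for g
  proof (rule measure_eqI)
    obtain S where S: "homeomorphism UNIV UNIV (T g) S" using T[OF g] ..
    then have "continuous_on UNIV (T g)" by (simp add: homeomorphism_def)
    then have "T g \<in> borel_measurable borel" by (rule borel_measurable_continuous_onI)
    then have meas: "T g \<in> measurable borel_extension borel"
      by (simp add: measurable_cong_sets[OF sets_borel_extension refl])
    fix A assume "A \<in> sets (distr borel_extension borel (T g))"
    then have A: "A \<in> sets borel" by simp
    have sp: "space borel_extension = UNIV"
      using sets_eq_imp_space_eq[OF sets_borel_extension] by simp
    have "T g -` A \<in> sets borel"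
      using measurable_sets[OF meas A] by (simp add: sp sets_borel_extension)
    then show "emeasure (distr borel_extension borel (T g)) A = emeasure borel_extension A"
      using A outer_content_homeo[OF S inv[OF g]]
      by (simp add: emeasure_distr[OF meas A] sp emeasure_borel_extension)
  qed (simp add: sets_borel_extension)
  then show ?thesis
    using borel_prob_extension unfolding inv_measures_def by blast
qed

section \<open>A maximal inequality along tempered sequences\<close>

text \<open>Item \<open>a\<close> has scale \<open>j a\<close> and set \<open>S a\<close>;
  \<open>N k\<close> stands for the size of the sets of scale \<open>k\<close>. \<open>mult\<close>
  bounds the overlap within one scale and \<open>meet\<close> abstracts temperedness. A rejected
  item charges at least 1 to selected items of larger scale that meet it, and each selected item is
  charged at most \<open>c\<close> in total.\<close>

lemma fractional_cover:
  fixes j :: "'i \<Rightarrow> nat" and S :: "'i \<Rightarrow> 'b set" and N :: "nat \<Rightarrow> nat" and c :: real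
  assumes A: "finite A" and N: "\<And>k. N k > 0"
    and mult: "\<And>k g. card {a \<in> A. j a = k \<and> g \<in> S a} \<le> N k"
    and meet: "\<And>b. b \<in> A \<Longrightarrow> real (card {a \<in> A. j a < j b \<and> S a \<inter> S b \<noteq> {}}) \<le> c * N (j b)"
  obtains B where "B \<subseteq> A" "real (card A) \<le> (1 + c) * card B"
    "\<And>g. (\<Sum>b\<in>{b \<in> B. g \<in> S b}. 1 / real (N (j b))) \<le> 2"
proof -
  define w where "w b = 1 / real (N (j b))" for b
  have w0: "0 \<le> w b" for b by (simp add: w_def)
  obtain M where M: "\<And>a. a \<in> A \<Longrightarrow> j a < M"
    using A by (metis bounded_nat_set_is_finite finite_imageI finite_nat_set_iff_bounded imageI)
  \<comment> \<open>The invariant after treating all scales from \<open>k\<close> on; the induction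
    descends from the bound \<open>M\<close> to 0. The last clause records that a rejection is
    caused by strictly larger scales, as \<open>meet\<close> requires.\<close>
  have "\<exists>B. B \<subseteq> {a \<in> A. k \<le> j a} \<and> (\<forall>g. (\<Sum>b\<in>{b \<in> B. g \<in> S b}. w b) \<le> 2) \<and>
      (\<forall>a\<in>{a \<in> A. k \<le> j a} - B. \<exists>g\<in>S a. 1 \<le> (\<Sum>b\<in>{b \<in> B. j a < j b \<and> g \<in> S b}. w b))"
    if "k \<le> M" for k
    using that
  proof (induction k rule: inc_induct)
    case base
    have "{a \<in> A. M \<le> j a} = {}" using M by force
    then show ?case by (intro exI[of _ "{}"]) simp
  next
    case (step k)
    then obtain B where B: "B \<subseteq> {a \<in> A. Suc k \<le> j a}" "\<And>g. (\<Sum>b\<in>{b \<in> B. g \<in> S b}. w b) \<le> 2"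
      "\<And>a. a \<in> {a \<in> A. Suc k \<le> j a} - B \<Longrightarrow> \<exists>g\<in>S a. 1 \<le> (\<Sum>b\<in>{b \<in> B. j a < j b \<and> g \<in> S b}. w b)"
      by blast
    have fB: "finite B" by (rule finite_subset[OF B(1)]) (use A in auto)
    define H where "H = {a \<in> A. j a = k \<and> (\<forall>g\<in>S a. (\<Sum>b\<in>{b \<in> B. g \<in> S b}. w b) < 1)}"
    have fH: "finite H" using A by (simp add: H_def)
    have BH: "B \<inter> H = {}" using B(1) by (auto simp: H_def)
    show ?case
    proof (intro exI[of _ "B \<union> H"] conjI allI ballI)
      show "B \<union> H \<subseteq> {a \<in> A. k \<le> j a}" using B(1) by (auto simp: H_def)
    next
      fix g
      have "{b \<in> B \<union> H. g \<in> S b} = {b \<in> B. g \<in> S b} \<union> {b \<in> H. g \<in> S b}" by auto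
      then have eq: "(\<Sum>b\<in>{b \<in> B \<union> H. g \<in> S b}. w b) =
          (\<Sum>b\<in>{b \<in> B. g \<in> S b}. w b) + (\<Sum>b\<in>{b \<in> H. g \<in> S b}. w b)"
        using fB fH BH by (simp only:) (rule sum.union_disjoint, auto)
      show "(\<Sum>b\<in>{b \<in> B \<union> H. g \<in> S b}. w b) \<le> 2"
      proof (cases "\<exists>b\<in>H. g \<in> S b")
        case True
        then have "(\<Sum>b\<in>{b \<in> B. g \<in> S b}. w b) < 1" by (auto simp: H_def)
        moreover have "(\<Sum>b\<in>{b \<in> H. g \<in> S b}. w b) = card {b \<in> H. g \<in> S b} / N k"
          by (simp add: w_def H_def)
        moreover have "card {b \<in> H. g \<in> S b} \<le> card {a \<in> A. j a = k \<and> g \<in> S a}"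
          using A by (intro card_mono) (auto simp: H_def)
        then have "card {b \<in> H. g \<in> S b} / N k \<le> 1"
          using mult[of k g] N[of k] by (simp add: divide_le_eq_1)
        ultimately show ?thesis using eq by linarith
      next
        case False
        then have "{b \<in> H. g \<in> S b} = {}" by auto
        then show ?thesis using eq B(2)[of g] by (simp only: sum.empty add_0_right)
      qed
    next
      fix a assume a: "a \<in> {a \<in> A. k \<le> j a} - (B \<union> H)"
      have "\<exists>g\<in>S a. 1 \<le> (\<Sum>b\<in>{b \<in> B. j a < j b \<and> g \<in> S b}. w b)"
      proof (cases "j a = k")
        case True
        have "\<And>g. {b \<in> B. j a < j b \<and> g \<in> S b} = {b \<in> B. g \<in> S b}" using B(1) True by auto
        then show ?thesis using a True by (auto simp: H_def not_less)
      qed (use a B(3)[of a] in auto)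
      then obtain g where g: "g \<in> S a" "1 \<le> (\<Sum>b\<in>{b \<in> B. j a < j b \<and> g \<in> S b}. w b)" by blast
      have "(\<Sum>b\<in>{b \<in> B. j a < j b \<and> g \<in> S b}. w b) \<le> (\<Sum>b\<in>{b \<in> B \<union> H. j a < j b \<and> g \<in> S b}. w b)"
        using fB fH w0 by (intro sum_mono2) auto
      with g show "\<exists>g\<in>S a. 1 \<le> (\<Sum>b\<in>{b \<in> B \<union> H. j a < j b \<and> g \<in> S b}. w b)" by force
    qed
  qed
  from this[of 0] obtain B where B: "B \<subseteq> A" "\<And>g. (\<Sum>b\<in>{b \<in> B. g \<in> S b}. w b) \<le> 2"
      "\<And>a. a \<in> A - B \<Longrightarrow> \<exists>g\<in>S a. 1 \<le> (\<Sum>b\<in>{b \<in> B. j a < j b \<and> g \<in> S b}. w b)"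
    by auto
  have fB: "finite B" using B(1) A by (rule finite_subset)
  have "real (card (A - B)) = (\<Sum>a\<in>A - B. 1)" by simp
  \<comment> \<open>Double counting of pairs of a rejected \<open>a\<close> and a selected
    \<open>b\<close>: seen from \<open>a\<close> the weight is at least 1, seen from
    \<open>b\<close> it is at most \<open>c\<close>.\<close>
  also have "\<dots> \<le> (\<Sum>a\<in>A - B. \<Sum>b\<in>{b \<in> B. j a < j b \<and> S a \<inter> S b \<noteq> {}}. w b)"
  proof (rule sum_mono)
    fix a assume "a \<in> A - B"
    from B(3)[OF this] obtain g where g: "g \<in> S a" "1 \<le> (\<Sum>b\<in>{b \<in> B. j a < j b \<and> g \<in> S b}. w b)" by blast
    note g(2)
    also have "(\<Sum>b\<in>{b \<in> B. j a < j b \<and> g \<in> S b}. w b) \<le> (\<Sum>b\<in>{b \<in> B. j a < j b \<and> S a \<inter> S b \<noteq> {}}. w b)"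
      using fB w0 g(1) by (intro sum_mono2) auto
    finally show "1 \<le> (\<Sum>b\<in>{b \<in> B. j a < j b \<and> S a \<inter> S b \<noteq> {}}. w b)" .
  qed
  also have "\<dots> = (\<Sum>b\<in>B. \<Sum>a\<in>{a \<in> A - B. j a < j b \<and> S a \<inter> S b \<noteq> {}}. w b)"
    using A fB by (intro sum.swap_restrict) auto
  also have "\<dots> \<le> (\<Sum>b\<in>B. c)"
  proof (rule sum_mono)
    fix b assume b: "b \<in> B"
    have "card {a \<in> A - B. j a < j b \<and> S a \<inter> S b \<noteq> {}} \<le> card {a \<in> A. j a < j b \<and> S a \<inter> S b \<noteq> {}}"
      using A by (intro card_mono) auto
    then have "real (card {a \<in> A - B. j a < j b \<and> S a \<inter> S b \<noteq> {}}) \<le> c * N (j b)"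
      using meet[of b] b B(1) by (meson of_nat_mono order_trans subsetD)
    then show "(\<Sum>a\<in>{a \<in> A - B. j a < j b \<and> S a \<inter> S b \<noteq> {}}. w b) \<le> c"
      using N[of "j b"] by (simp add: w_def divide_le_eq)
  qed
  finally have "real (card (A - B)) \<le> card B * c" by simp
  moreover have "card A = card (A - B) + card B"
    using A B(1) fB by (metis card_Diff_subset card_mono le_add_diff_inverse2)
  ultimately have "real (card A) \<le> (1 + c) * card B" by (simp add: algebra_simps)
  then show ?thesis using that B unfolding w_def by blast
qed

text \<open>The fractional cover replaces the disjoint subfamily of the classical covering argument:
  each selected set contributes at least \<open>t\<close> to a weighted sum of
  \<open>\<phi>\<close>, in which no point has total weight above 2.\<close>

lemma weak_type_counting:
  fixes j :: "'i \<Rightarrow> nat" and S :: "'i \<Rightarrow> 'b set" and N :: "nat \<Rightarrow> nat" and \<phi> :: "'b \<Rightarrow> real" and c t :: real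
  assumes A: "finite A" and N: "\<And>k. N k > 0"
    and mult: "\<And>k g. card {a \<in> A. j a = k \<and> g \<in> S a} \<le> N k"
    and meet: "\<And>b. b \<in> A \<Longrightarrow> real (card {a \<in> A. j a < j b \<and> S a \<inter> S b \<noteq> {}}) \<le> c * N (j b)"
    and c: "0 \<le> c" and t: "0 \<le> t"
    and Q: "finite Q" "\<And>a. a \<in> A \<Longrightarrow> S a \<subseteq> Q" and \<phi>: "\<And>g. g \<in> Q \<Longrightarrow> 0 \<le> \<phi> g"
    and large: "\<And>a. a \<in> A \<Longrightarrow> t * N (j a) \<le> (\<Sum>g\<in>S a. \<phi> g)"
  shows "t * card A \<le> 2 * (1 + c) * (\<Sum>g\<in>Q. \<phi> g)"
proof -
  obtain B where B: "B \<subseteq> A" "real (card A) \<le> (1 + c) * card B"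
    "\<And>g. (\<Sum>b\<in>{b \<in> B. g \<in> S b}. 1 / real (N (j b))) \<le> 2"
    using fractional_cover[OF A N mult meet] by blast
  have fB: "finite B" using B(1) A by (rule finite_subset)
  have "t * card B = (\<Sum>b\<in>B. t)" by simp
  also have "\<dots> \<le> (\<Sum>b\<in>B. \<Sum>g\<in>{g \<in> Q. g \<in> S b}. \<phi> g / N (j b))"
  proof (rule sum_mono)
    fix b assume b: "b \<in> B"
    then have "{g \<in> Q. g \<in> S b} = S b" using Q B(1) by auto
    then show "t \<le> (\<Sum>g\<in>{g \<in> Q. g \<in> S b}. \<phi> g / N (j b))"
      using large[of b] b B(1) N[of "j b"] by (auto simp: sum_divide_distrib[symmetric] le_divide_eq)
  qed
  also have "\<dots> = (\<Sum>g\<in>Q. \<Sum>b\<in>{b \<in> B. g \<in> S b}. \<phi> g / N (j b))"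
    using Q(1) fB by (intro sum.swap_restrict)
  also have "\<dots> = (\<Sum>g\<in>Q. \<phi> g * (\<Sum>b\<in>{b \<in> B. g \<in> S b}. 1 / N (j b)))"
    by (simp add: sum_distrib_left)
  also have "\<dots> \<le> (\<Sum>g\<in>Q. \<phi> g * 2)"
    by (intro sum_mono mult_left_mono B(3) \<phi>)
  finally have "t * card B \<le> 2 * (\<Sum>g\<in>Q. \<phi> g)" by (simp add: sum_distrib_right[symmetric])
  then have "(1 + c) * (t * card B) \<le> (1 + c) * (2 * (\<Sum>g\<in>Q. \<phi> g))"
    using c by (intro mult_left_mono) auto
  moreover have "t * card A \<le> t * ((1 + c) * card B)"
    using B(2) t by (rule mult_left_mono)
  ultimately show ?thesis by (simp add: algebra_simps)
qed

section \<open>Folner averages and counting along orbits\<close>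

locale folner_action = group G for G (structure) +
  fixes T :: "'g \<Rightarrow> 'a::metric_space \<Rightarrow> 'a" and F :: "nat \<Rightarrow> 'g set"
  assumes compact_space: "compact (UNIV :: 'a set)"
    and act: "homeo_action G T" and folner: "folner_seq G F"
begin

lemma F_carrier: "F k \<subseteq> carrier G" and F_finite: "finite (F k)" and F_nonempty: "F k \<noteq> {}"
  using folner by (auto simp: folner_seq_def)

lemma card_F: "0 < card (F k)"
  by (simp add: F_finite F_nonempty card_gt_0_iff)

lemma T_comp:
  assumes "g \<in> carrier G" "h \<in> carrier G"
  shows "T (g \<otimes> h) x = T g (T h x)"
proof -
  have "T g \<circ> T h = T (g \<otimes> h)" using act assms by (simp add: homeo_action_iff)
  then show ?thesis by (metis comp_apply)
qed

lemma continuous_T: "g \<in> carrier G \<Longrightarrow> continuous_on UNIV (T g)"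
  using act unfolding homeo_action_iff homeomorphism_def by blast

lemma continuous_Avg:
  assumes "continuous_on UNIV f"
  shows "continuous_on UNIV (Avg T (F k) f)"
proof -
  have "continuous_on UNIV (\<lambda>x. f (T g x))" if "g \<in> F k" for g
    using continuous_on_compose2[OF assms continuous_T] F_carrier[of k] that by blast
  then show ?thesis
    unfolding Avg_def comp_def using card_F[of k] by (intro continuous_intros) auto
qed

lemma card_mult_left_diff:
  assumes "g \<in> carrier G"
  shows "(\<lambda>k. real (card ((g <# F k) - F k)) / card (F k)) \<longlonglongrightarrow> 0"
proof (rule tendsto_sandwich[OF _ _ tendsto_const])
  show "(\<lambda>k. real (card (sym_diff (F k) (g <# F k))) / real (card (F k))) \<longlonglongrightarrow> 0"
    using folner assms by (simp add: folner_seq_def)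
  have "finite (g <# F k)" for k by (simp add: l_coset_def F_finite)
  then show "\<forall>\<^sub>F k in sequentially. real (card ((g <# F k) - F k)) / card (F k) \<le>
      real (card (sym_diff (F k) (g <# F k))) / real (card (F k))"
    by (intro always_eventually allI divide_right_mono of_nat_mono card_mono) (auto simp: F_finite)
qed simp

text \<open>The items are orbit positions \<open>a\<close>, scaled by an index at which the average
  is large, with the translate \<open>F (j a) #> a\<close> as set. The action law turns the average
  at \<open>T a x\<close> into a sum over this translate.\<close>

lemma Avg_maximal_count:
  fixes \<phi> :: "'a \<Rightarrow> real" and c t :: real
  assumes c: "0 \<le> c" and temp: "\<And>k. 1 \<le> k \<Longrightarrow> real (card (\<Union>j<k. set_inv (F j) <#> F k)) \<le> c * card (F k)"
    and \<phi>: "\<And>x. 0 \<le> \<phi> x" and t: "0 \<le> t" and E: "finite E" "E \<subseteq> carrier G"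
  shows "t * card {a \<in> E. \<exists>k<N. t < Avg T (F k) \<phi> (T a x)}
    \<le> 2 * (1 + c) * (\<Sum>g\<in>(\<Union>k<N. F k) <#> E. \<phi> (T g x))"
proof -
  define A where "A = {a \<in> E. \<exists>k<N. t < Avg T (F k) \<phi> (T a x)}"
  define j where "j a = (LEAST k. t < Avg T (F k) \<phi> (T a x))" for a
  define S where "S a = F (j a) #> a" for a
  have A: "finite A" "A \<subseteq> carrier G" "A \<subseteq> E" using E by (auto simp: A_def)
  have j: "t < Avg T (F (j a)) \<phi> (T a x)" "j a < N" if "a \<in> A" for a
  proof -
    from that obtain k where k: "k < N" "t < Avg T (F k) \<phi> (T a x)" by (auto simp: A_def)
    show "t < Avg T (F (j a)) \<phi> (T a x)" unfolding j_def
      by (rule LeastI[of "\<lambda>k. t < Avg T (F k) \<phi> (T a x)", OF k(2)])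
    show "j a < N" using Least_le[of "\<lambda>k. t < Avg T (F k) \<phi> (T a x)", OF k(2)] k(1) by (simp add: j_def)
  qed
  have Fc: "h \<in> carrier G" if "h \<in> F k" for h k using that F_carrier by blast
  have "t * card A \<le> 2 * (1 + c) * (\<Sum>g\<in>(\<Union>k<N. F k) <#> E. \<phi> (T g x))"
  proof (rule weak_type_counting[where N = "\<lambda>k. card (F k)" and j = j and S = S])
    fix k g
    have "{a \<in> A. j a = k \<and> g \<in> S a} \<subseteq> (\<lambda>h. inv h \<otimes> g) ` F k"
    proof
      fix a assume "a \<in> {a \<in> A. j a = k \<and> g \<in> S a}"
      then obtain h where h: "h \<in> F k" "g = h \<otimes> a" "a \<in> carrier G"
        using A(2) by (auto simp: S_def r_coset_def)
      then have "a = inv h \<otimes> g" using Fc by (simp add: m_assoc[symmetric])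
      with h show "a \<in> (\<lambda>h. inv h \<otimes> g) ` F k" by blast
    qed
    then show "card {a \<in> A. j a = k \<and> g \<in> S a} \<le> card (F k)"
      by (rule surj_card_le[OF F_finite])
  next
    fix b assume b: "b \<in> A"
    then have bc: "b \<in> carrier G" using A by auto
    let ?U = "\<Union>i<j b. set_inv (F i) <#> F (j b)"
    let ?M = "{a \<in> A. j a < j b \<and> S a \<inter> S b \<noteq> {}}"
    show "real (card ?M) \<le> c * card (F (j b))"
    \<comment> \<open>The temperedness bound starts at index 1; for index 0 there is no smaller
      scale and the set is empty.\<close>
    proof (cases "j b = 0")
      case False
      have fU: "finite ?U"
        by (auto simp: set_mult_def SET_INV_def F_finite)
      \<comment> \<open>A common point \<open>h \<otimes> a = h' \<otimes> b\<close> forces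
        \<open>a = inv h \<otimes> h' \<otimes> b\<close>, so all candidates lie in a right
        translate of the set that temperedness controls.\<close>
      have "?M \<subseteq> (\<lambda>u. u \<otimes> b) ` ?U"
      proof
        fix a assume a: "a \<in> ?M"
        then have ac: "a \<in> carrier G" using A by auto
        obtain h h' where h: "h \<in> F (j a)" "h' \<in> F (j b)" "h \<otimes> a = h' \<otimes> b"
          using a by (auto simp: S_def r_coset_def)
        have "a = inv h \<otimes> (h \<otimes> a)" using Fc[OF h(1)] ac by (simp add: m_assoc[symmetric])
        also have "\<dots> = inv h \<otimes> h' \<otimes> b" using h Fc bc by (simp add: m_assoc)
        finally have "a = inv h \<otimes> h' \<otimes> b" .
        moreover have "inv h \<otimes> h' \<in> ?U"
          using a h by (auto simp: set_mult_def SET_INV_def)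
        ultimately show "a \<in> (\<lambda>u. u \<otimes> b) ` ?U" by blast
      qed
      then have "card ?M \<le> card ?U" by (rule surj_card_le[OF fU])
      then show ?thesis using temp[of "j b"] False by linarith
    qed (simp add: c)
  next
    show "finite ((\<Union>k<N. F k) <#> E)" by (auto simp: set_mult_def F_finite E)
  next
    fix a assume a: "a \<in> A"
    then have ac: "a \<in> carrier G" using A by auto
    show "S a \<subseteq> (\<Union>k<N. F k) <#> E"
      using a A(3) j(2)[OF a] unfolding S_def r_coset_def set_mult_def by blast
    have inj: "inj_on (\<lambda>h. h \<otimes> a) (F (j a))"
      using Fc ac by (auto simp: inj_on_def)
    have "S a = (\<lambda>h. h \<otimes> a) ` F (j a)" by (auto simp: S_def r_coset_def)
    then have "(\<Sum>g\<in>S a. \<phi> (T g x)) = (\<Sum>h\<in>F (j a). \<phi> (T (h \<otimes> a) x))"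
      using sum.reindex[OF inj] by simp
    also have "\<dots> = (\<Sum>h\<in>F (j a). \<phi> (T h (T a x)))"
      using Fc ac by (intro sum.cong) (auto simp: T_comp)
    finally show "t * card (F (j a)) \<le> (\<Sum>g\<in>S a. \<phi> (T g x))"
      using j(1)[OF a] card_F[of "j a"] by (simp add: Avg_def less_divide_eq)
  qed (use A card_F c t \<phi> in auto)
  then show ?thesis by (simp add: A_def)
qed

end

section \<open>Points realising the extremal averages\<close>

lemma bounded_continuous_real:
  fixes f :: "'a::topological_space \<Rightarrow> real"
  assumes "compact (UNIV :: 'a set)" "continuous_on UNIV f"
  obtains b where "0 \<le> b" "\<And>x. \<bar>f x\<bar> \<le> b"
proof -
  have "bounded (range f)" using assms by (simp add: compact_continuous_image compact_imp_bounded)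
  then obtain b where "\<And>x. \<bar>f x\<bar> \<le> b" by (auto simp: bounded_iff)
  then show ?thesis using that[of b] abs_ge_zero order_trans by blast
qed

section \<open>Almost invariance of the averages\<close>

context folner_action
begin

lemma Avg_le:
  assumes "\<And>x. f x \<le> b"
  shows "Avg T (F k) f x \<le> b"
proof -
  have "(\<Sum>g\<in>F k. f (T g x)) \<le> (\<Sum>g\<in>F k. b)" by (intro sum_mono assms)
  then show ?thesis using card_F[of k] by (simp add: Avg_def divide_le_eq mult.commute)
qed

lemma Avg_ge:
  assumes "\<And>x. b \<le> f x"
  shows "b \<le> Avg T (F k) f x"
proof -
  have "(\<Sum>g\<in>F k. b) \<le> (\<Sum>g\<in>F k. f (T g x))" by (intro sum_mono assms)
  then show ?thesis using card_F[of k] by (simp add: Avg_def le_divide_eq mult.commute)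
qed

lemma abs_Avg_le:
  assumes "\<And>x. \<bar>f x\<bar> \<le> b"
  shows "\<bar>Avg T (F k) f x\<bar> \<le> b"
proof -
  have "f x \<le> b" "- b \<le> f x" for x using assms[of x] by linarith+
  then have "Avg T (F k) f x \<le> b" "- b \<le> Avg T (F k) f x"
    using Avg_le[of f b] Avg_ge[of "-b" f] by blast+
  then show ?thesis by linarith
qed

lemma Avg_const_diff: "Avg T (F k) (\<lambda>x. b - f x) y = b - Avg T (F k) f y"
  using card_F[of k] by (simp add: Avg_def sum_subtractf diff_divide_distrib)

lemma Avg_uminus: "Avg T (F k) (\<lambda>x. - f x) y = - Avg T (F k) f y"
  using Avg_const_diff[of k 0 f y] by simp

text \<open>Composing with \<open>T g\<close> moves the averaging set from \<open>F n\<close> to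
  \<open>g <# F n\<close>. The two sums cancel outside the symmetric difference, which is negligible
  by the Folner property, uniformly in \<open>x\<close>.\<close>

lemma Avg_translate_tendsto:
  assumes b: "\<And>x. \<bar>f x\<bar> \<le> b" and g: "g \<in> carrier G"
  obtains e where "e \<longlonglongrightarrow> 0" "\<And>n x. \<bar>Avg T (F n) (\<lambda>x. f (T g x)) x - Avg T (F n) f x\<bar> \<le> e n"
proof
  define e where "e n = b * (real (card (sym_diff (F n) (g <# F n))) / real (card (F n)))" for n
  have b0: "0 \<le> b" using b[of undefined] by linarith
  show "e \<longlonglongrightarrow> 0"
    unfolding e_def using folner g by (intro tendsto_mult_right_zero) (simp add: folner_seq_def)
  fix n x
  define \<phi> where "\<phi> h = f (T h x)" for h
  have fin: "finite (g <# F n)" by (simp add: l_coset_def F_finite)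
  have gF: "g <# F n = (\<lambda>h. g \<otimes> h) ` F n" by (auto simp: l_coset_def)
  have inj: "inj_on (\<lambda>h. g \<otimes> h) (F n)"
    using g F_carrier[of n] by (intro inj_onI) (metis Units_eq Units_l_cancel subsetD)
  have "(\<Sum>h\<in>F n. f (T g (T h x))) = (\<Sum>h\<in>F n. \<phi> (g \<otimes> h))"
    using g F_carrier[of n] by (intro sum.cong) (auto simp: T_comp \<phi>_def)
  also have "\<dots> = (\<Sum>h\<in>g <# F n. \<phi> h)" unfolding gF by (simp add: sum.reindex[OF inj])
  finally have "(\<Sum>h\<in>F n. f (T g (T h x))) - (\<Sum>h\<in>F n. \<phi> h) =
      (\<Sum>h\<in>(g <# F n) - F n. \<phi> h) - (\<Sum>h\<in>F n - (g <# F n). \<phi> h)"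
    using sum.Int_Diff[OF fin, of \<phi> "F n"] sum.Int_Diff[OF F_finite, of \<phi> n "g <# F n"]
    by (simp add: Int_commute)
  also have "\<bar>\<dots>\<bar> \<le> \<bar>\<Sum>h\<in>(g <# F n) - F n. \<phi> h\<bar> + \<bar>\<Sum>h\<in>F n - (g <# F n). \<phi> h\<bar>"
    by linarith
  also have "\<dots> \<le> (\<Sum>h\<in>(g <# F n) - F n. b) + (\<Sum>h\<in>F n - (g <# F n). b)"
    by (intro add_mono order_trans[OF sum_abs] sum_mono) (simp_all add: \<phi>_def b)
  also have "\<dots> = (\<Sum>h\<in>sym_diff (F n) (g <# F n). b)"
    by (subst sum.union_disjoint) (auto simp: fin F_finite)
  also have "\<dots> = b * card (sym_diff (F n) (g <# F n))" by simp
  finally have "\<bar>(\<Sum>h\<in>F n. f (T g (T h x))) - (\<Sum>h\<in>F n. \<phi> h)\<bar> / card (F n)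
      \<le> b * card (sym_diff (F n) (g <# F n)) / card (F n)"
    by (rule divide_right_mono) simp
  then show "\<bar>Avg T (F n) (\<lambda>x. f (T g x)) x - Avg T (F n) f x\<bar> \<le> e n"
    by (simp add: Avg_def e_def \<phi>_def diff_divide_distrib[symmetric] abs_divide)
qed

text \<open>The inner average is a finite mean of translates of \<open>f\<close>, so the translation
  errors can be averaged over \<open>F m\<close>.\<close>

lemma Avg_Avg_tendsto:
  assumes b: "\<And>x. \<bar>f x\<bar> \<le> b"
  obtains e where "e \<longlonglongrightarrow> 0" "\<And>n x. \<bar>Avg T (F n) (Avg T (F m) f) x - Avg T (F n) f x\<bar> \<le> e n"
proof -
  have "\<exists>e. e \<longlonglongrightarrow> 0 \<and> (\<forall>n x. \<bar>Avg T (F n) (\<lambda>x. f (T g x)) x - Avg T (F n) f x\<bar> \<le> e n)"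
    if "g \<in> F m" for g
  proof -
    from that have "g \<in> carrier G" using F_carrier by blast
    from Avg_translate_tendsto[where f = f, OF b this] show ?thesis by metis
  qed
  then obtain e where e: "\<And>g. g \<in> F m \<Longrightarrow> e g \<longlonglongrightarrow> 0"
    "\<And>g n x. g \<in> F m \<Longrightarrow> \<bar>Avg T (F n) (\<lambda>x. f (T g x)) x - Avg T (F n) f x\<bar> \<le> e g n"
    by metis
  show ?thesis
  proof
    show "(\<lambda>n. (\<Sum>g\<in>F m. e g n) / card (F m)) \<longlonglongrightarrow> 0"
      by (intro tendsto_divide_zero tendsto_null_sum e)
    fix n x
    have "Avg T (F n) (Avg T (F m) f) x
        = (\<Sum>h\<in>F n. \<Sum>g\<in>F m. f (T g (T h x)) / card (F m)) / card (F n)"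
      by (simp add: Avg_def sum_divide_distrib)
    also have "\<dots> = (\<Sum>g\<in>F m. Avg T (F n) (\<lambda>x. f (T g x)) x) / card (F m)"
      by (subst sum.swap) (simp add: Avg_def sum_divide_distrib mult.commute)
    also have "\<dots> - Avg T (F n) f x
        = (\<Sum>g\<in>F m. Avg T (F n) (\<lambda>x. f (T g x)) x - Avg T (F n) f x) / card (F m)"
      using card_F[of m] by (simp add: sum_subtractf diff_divide_distrib)
    also have "\<bar>\<dots>\<bar> \<le> (\<Sum>g\<in>F m. e g n) / card (F m)"
      unfolding abs_divide abs_of_nat
      by (intro divide_right_mono order_trans[OF sum_abs] sum_mono e(2)) auto
    finally show "\<bar>Avg T (F n) (Avg T (F m) f) x - Avg T (F n) f x\<bar> \<le> (\<Sum>g\<in>F m. e g n) / card (F m)" .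
  qed
qed

text \<open>The maximal inequality sums over a thickened set. For finite \<open>P\<close> the part
  of \<open>P <#> F n\<close> outside \<open>F n\<close> is negligible relative to
  \<open>F n\<close>, and \<open>\<phi>\<close> is bounded there.\<close>

lemma sum_thickened_le:
  assumes b: "\<And>x. 0 \<le> \<phi> x" "\<And>x. \<phi> x \<le> b" and P: "finite P" "P \<subseteq> carrier G"
  obtains e where "e \<longlonglongrightarrow> 0"
    "\<And>n x. (\<Sum>g\<in>P <#> F n. \<phi> (T g x)) \<le> card (F n) * (Avg T (F n) \<phi> x + e n)"
proof
  define e where "e n = b * (\<Sum>p\<in>P. real (card ((p <# F n) - F n)) / card (F n))" for n
  show "e \<longlonglongrightarrow> 0"
    unfolding e_def using P(2) by (intro tendsto_mult_right_zero tendsto_null_sum card_mult_left_diff) auto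
  fix n x
  have b0: "0 \<le> b" using b[of undefined] by linarith
  have PF: "P <#> F n = (\<Union>p\<in>P. p <# F n)" by (auto simp: set_mult_def l_coset_def)
  have fin: "finite (p <# F n)" for p by (simp add: l_coset_def F_finite)
  then have fPF: "finite (P <#> F n)" unfolding PF using P by auto
  have "(\<Sum>g\<in>P <#> F n. \<phi> (T g x))
      = (\<Sum>g\<in>(P <#> F n) \<inter> F n. \<phi> (T g x)) + (\<Sum>g\<in>(P <#> F n) - F n. \<phi> (T g x))"
    by (rule sum.Int_Diff[OF fPF])
  also have "\<dots> \<le> (\<Sum>g\<in>F n. \<phi> (T g x)) + (\<Sum>g\<in>(P <#> F n) - F n. b)"
    by (intro add_mono sum_mono sum_mono2) (auto simp: b F_finite)
  also have "(\<Sum>g\<in>(P <#> F n) - F n. b) = card ((P <#> F n) - F n) * b" by simp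
  also have "\<dots> \<le> (\<Sum>p\<in>P. real (card ((p <# F n) - F n))) * b"
  proof (rule mult_right_mono[OF _ b0])
    have "(P <#> F n) - F n = (\<Union>p\<in>P. (p <# F n) - F n)" unfolding PF by auto
    then show "real (card ((P <#> F n) - F n)) \<le> (\<Sum>p\<in>P. real (card ((p <# F n) - F n)))"
      using card_UN_le[OF P(1), of "\<lambda>p. (p <# F n) - F n"] by (metis of_nat_mono of_nat_sum)
  qed
  finally show "(\<Sum>g\<in>P <#> F n. \<phi> (T g x)) \<le> card (F n) * (Avg T (F n) \<phi> x + e n)"
    using card_F[of n]
    by (simp add: Avg_def e_def distrib_left sum_divide_distrib[symmetric] mult.commute)
qed

text \<open>Points where an average reaches \<open>\<beta>\<close> depend on the index; the
  weak-type bound and compactness replace them by a single point. Small averages of the deficiencies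
  there give lower bounds for the averages of \<open>f\<close> by almost invariance.\<close>

lemma exists_dominating_point:
  assumes temp: "tempered G F" and cont: "continuous_on UNIV f"
    and \<beta>: "\<And>n. \<exists>x. \<beta> \<le> Avg T (F n) f x" and M: "\<And>n x. Avg T (F n) f x \<le> M n"
    and M_lim: "\<And>e. 0 < e \<Longrightarrow> \<exists>n. M n \<le> \<beta> + e"
  obtains x where "\<And>e. 0 < e \<Longrightarrow> \<forall>\<^sub>F k in sequentially. \<beta> - e < Avg T (F k) f x"
proof -
  obtain b where b: "0 \<le> b" "\<And>x. \<bar>f x\<bar> \<le> b" using bounded_continuous_real[OF compact_space cont] by blast
  obtain c :: real where c: "0 < c"
    "\<And>k. 1 \<le> k \<Longrightarrow> real (card (\<Union>j<k. set_inv (F j) <#> F k)) \<le> c * card (F k)"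
    using temp by (auto simp: tempered_def)
  define \<delta> :: "nat \<Rightarrow> real" where "\<delta> i = (1/2)^i" for i
  \<comment> \<open>Chosen so that the constant \<open>2 * (1 + c)\<close>, a mean of at most
    \<open>2 * \<eta> i\<close> and the threshold \<open>\<delta> i\<close> give a bad proportion of
    at most \<open>(1/2)^(i + 2)\<close>; these sum to at most 1/2.\<close>
  define \<eta> where "\<eta> i = \<delta> i * (1/2)^(i + 2) / (4 * (1 + c))" for i
  have \<delta>: "0 < \<delta> i" for i by (simp add: \<delta>_def)
  have \<eta>: "0 < \<eta> i" for i using \<delta>[of i] c(1) by (simp add: \<eta>_def)
  obtain m where m: "\<And>i. M (m i) \<le> \<beta> + \<eta> i" using M_lim[OF \<eta>] by metis
  define \<psi> where "\<psi> i x = M (m i) - Avg T (F (m i)) f x" for i x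
  have \<psi>0: "0 \<le> \<psi> i x" for i x using M by (simp add: \<psi>_def)
  have contAvg: "continuous_on UNIV (Avg T (F k) (\<psi> i))" for i k
    unfolding \<psi>_def by (intro continuous_Avg continuous_intros cont)
  \<comment> \<open>Truncation to finitely many conditions, which the counting can meet. The closed
    sets \<open>Z N\<close> decrease, so compactness yields a point satisfying all
    conditions.\<close>
  define Z where "Z N = {x. \<forall>i<N. \<forall>k<N. Avg T (F k) (\<psi> i) x \<le> \<delta> i}" for N
  have Zclosed: "closed (Z N)" for N
  proof -
    have "Z N = (\<Inter>i\<in>{..<N}. \<Inter>k\<in>{..<N}. {x. Avg T (F k) (\<psi> i) x \<le> \<delta> i})" by (auto simp: Z_def)
    then show ?thesis
      using contAvg by (auto intro!: closed_INT closed_Collect_le continuous_on_const)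
  qed
  have Zne: "Z N \<noteq> {}" for N
  proof -
    define P where "P = (\<Union>k<N. F k)"
    have P: "finite P" "P \<subseteq> carrier G" using F_finite F_carrier by (auto simp: P_def)
    have "\<forall>\<^sub>F n in sequentially. \<forall>x. \<beta> \<le> Avg T (F n) f x \<longrightarrow>
        (\<Sum>g\<in>P <#> F n. \<psi> i (T g x)) \<le> card (F n) * (2 * \<eta> i)" for i
    proof -
      have "\<psi> i x \<le> M (m i) + b" for x
        using abs_Avg_le[where f = f, OF b(2), of "m i" x] unfolding \<psi>_def by linarith
      then obtain e where e: "e \<longlonglongrightarrow> 0"
        "\<And>n x. (\<Sum>g\<in>P <#> F n. \<psi> i (T g x)) \<le> card (F n) * (Avg T (F n) (\<psi> i) x + e n)"
        using sum_thickened_le[of "\<psi> i" "M (m i) + b", OF \<psi>0 _ P] by metis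
      obtain e' where e': "e' \<longlonglongrightarrow> 0"
        "\<And>n x. \<bar>Avg T (F n) (Avg T (F (m i)) f) x - Avg T (F n) f x\<bar> \<le> e' n"
        using Avg_Avg_tendsto[of f b, OF b(2)] by metis
      \<comment> \<open>Where the \<open>n\<close>-th average of \<open>f\<close> is at least
        \<open>\<beta>\<close>, the deficiency averages to at most \<open>\<eta> i + e' n\<close>,
        and thickening costs a further \<open>e n\<close>; together the errors must drop below
        \<open>\<eta> i\<close>.\<close>
      have "(\<lambda>n. e n + e' n) \<longlonglongrightarrow> 0 + 0" by (intro tendsto_add e e')
      then have "\<forall>\<^sub>F n in sequentially. e n + e' n < \<eta> i"
        using \<eta>[of i] by (intro order_tendstoD(2)) auto
      then show ?thesis
      proof eventually_elim
        case (elim n)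
        show ?case
        proof (intro allI impI)
          fix x assume x: "\<beta> \<le> Avg T (F n) f x"
          have "Avg T (F n) (\<psi> i) x = M (m i) - Avg T (F n) (Avg T (F (m i)) f) x"
            unfolding \<psi>_def by (rule Avg_const_diff)
          then have "Avg T (F n) (\<psi> i) x + e n \<le> 2 * \<eta> i"
            using x e'(2)[of n x] m[of i] elim by linarith
          then have "card (F n) * (Avg T (F n) (\<psi> i) x + e n) \<le> card (F n) * (2 * \<eta> i)"
            by (intro mult_left_mono) auto
          then show "(\<Sum>g\<in>P <#> F n. \<psi> i (T g x)) \<le> card (F n) * (2 * \<eta> i)"
            using e(2)[where n = n and x = x] by linarith
        qed
      qed
    qed
    then have "\<forall>\<^sub>F n in sequentially. \<forall>i\<in>{..<N}. \<forall>x. \<beta> \<le> Avg T (F n) f x \<longrightarrow>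
        (\<Sum>g\<in>P <#> F n. \<psi> i (T g x)) \<le> card (F n) * (2 * \<eta> i)"
      by (intro eventually_ball_finite) auto
    then obtain n where n: "\<And>i x. i < N \<Longrightarrow> \<beta> \<le> Avg T (F n) f x \<Longrightarrow>
        (\<Sum>g\<in>P <#> F n. \<psi> i (T g x)) \<le> card (F n) * (2 * \<eta> i)"
      by (auto simp: eventually_sequentially)
    obtain x where x: "\<beta> \<le> Avg T (F n) f x" using \<beta> by blast
    define Bad where "Bad i = {a \<in> F n. \<exists>k<N. \<delta> i < Avg T (F k) (\<psi> i) (T a x)}" for i
    have bad: "real (card (Bad i)) \<le> card (F n) * (1/2)^(i + 2)" if "i < N" for i
    proof -
      have "\<delta> i * card (Bad i) \<le> 2 * (1 + c) * (\<Sum>g\<in>P <#> F n. \<psi> i (T g x))"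
        unfolding Bad_def P_def
        by (rule Avg_maximal_count) (use c \<delta>[of i] \<psi>0 F_finite F_carrier in auto)
      also have "\<dots> \<le> 2 * (1 + c) * (card (F n) * (2 * \<eta> i))"
        by (rule mult_left_mono[OF n[OF that x]]) (use c in auto)
      also have "\<dots> = \<delta> i * (card (F n) * (1/2)^(i + 2))"
      proof -
        have "4 * (1 + c) * \<eta> i = \<delta> i * (1/2)^(i + 2)" using c(1) unfolding \<eta>_def times_divide_eq_right
          by (intro nonzero_mult_div_cancel_left) simp
        moreover have "2 * (1 + c) * (card (F n) * (2 * \<eta> i)) = card (F n) * (4 * (1 + c) * \<eta> i)"
          by (simp add: algebra_simps)
        ultimately show ?thesis by (simp only: mult.left_commute)
      qed
      finally show ?thesis using \<delta>[of i] by simp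
    qed
    have "real (card (\<Union>i<N. Bad i)) \<le> (\<Sum>i<N. real (card (Bad i)))"
      using card_UN_le[of "{..<N}" Bad] by (metis finite_lessThan of_nat_mono of_nat_sum)
    also have "\<dots> \<le> (\<Sum>i<N. card (F n) * (1/2)^(i + 2))" by (intro sum_mono bad) auto
    also have "\<dots> = card (F n) / 4 * (\<Sum>i<N. (1/2)^i)"
      by (simp add: sum_distrib_left power_add)
    also have "(\<Sum>i<N. (1/2::real)^i) \<le> 2"
      by (simp add: geometric_sum)
    then have "card (F n) / 4 * (\<Sum>i<N. (1/2::real)^i) \<le> card (F n) / 4 * 2"
      by (rule mult_left_mono) simp
    \<comment> \<open>At least half of the positions in \<open>F n\<close> are good for all
      \<open>i < N\<close> at once, so the orbit of \<open>x\<close> meets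
      \<open>Z N\<close>.\<close>
    finally have "real (card (\<Union>i<N. Bad i)) < card (F n)" using card_F[of n] by simp
    then have "\<not> F n \<subseteq> (\<Union>i<N. Bad i)"
      using card_mono[of "\<Union>i<N. Bad i" "F n"] F_finite by (fastforce simp: Bad_def)
    then obtain a where "a \<in> F n" "\<And>i. i < N \<Longrightarrow> a \<notin> Bad i" by blast
    then have "\<not> \<delta> i < Avg T (F k) (\<psi> i) (T a x)" if "i < N" "k < N" for i k
      using that by (auto simp: Bad_def)
    then have "T a x \<in> Z N" by (simp add: Z_def not_less)
    then show ?thesis by blast
  qed
  have "UNIV \<inter> (\<Inter>N\<in>UNIV. Z N) \<noteq> {}"
  proof (rule compact_imp_fip_image[OF compact_space])
    fix I :: "nat set" assume I: "finite I"
    \<comment> \<open>\<open>insert 0\<close> keeps the argument of \<open>Max\<close> nonempty when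
      \<open>I\<close> is empty.\<close>
    have "Z (Suc (Max (insert 0 I))) \<subseteq> Z N" if "N \<in> I" for N
    proof -
      have "N \<le> Max (insert 0 I)" using I that by (intro Max_ge) auto
      then show ?thesis by (auto simp: Z_def)
    qed
    then show "UNIV \<inter> (\<Inter>N\<in>I. Z N) \<noteq> {}" using Zne[of "Suc (Max (insert 0 I))"] by blast
  qed (rule Zclosed)
  then obtain x where xZ: "\<And>N. x \<in> Z N" by blast
  have x: "Avg T (F k) (\<psi> i) x \<le> \<delta> i" for i k
    using xZ[of "Suc (max i k)"] by (auto simp: Z_def)
  show ?thesis
  proof
    fix \<epsilon> :: real assume \<epsilon>: "0 < \<epsilon>"
    obtain i where i: "\<delta> i < \<epsilon> / 2"
      using real_arch_pow_inv[of "\<epsilon> / 2" "1/2"] \<epsilon> by (auto simp: \<delta>_def)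
    obtain e where e: "e \<longlonglongrightarrow> 0"
      "\<And>n x. \<bar>Avg T (F n) (Avg T (F (m i)) f) x - Avg T (F n) f x\<bar> \<le> e n"
      using Avg_Avg_tendsto[of f b, OF b(2)] by metis
    have "\<forall>\<^sub>F n in sequentially. e n < \<epsilon> / 2"
      using \<epsilon> e(1) by (intro order_tendstoD(2)) auto
    then show "\<forall>\<^sub>F k in sequentially. \<beta> - \<epsilon> < Avg T (F k) f x"
    proof eventually_elim
      case (elim k)
      have "Avg T (F k) (\<psi> i) x = M (m i) - Avg T (F k) (Avg T (F (m i)) f) x"
        unfolding \<psi>_def by (rule Avg_const_diff)
      \<comment> \<open>\<open>M (m i)\<close> bounds an average that reaches
        \<open>\<beta>\<close>, so it is at least \<open>\<beta>\<close>; the deficiency bound and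
        the almost-invariance error each cost less than half of \<open>\<epsilon>\<close>.\<close>
      moreover obtain y where "\<beta> \<le> Avg T (F (m i)) f y" using \<beta> by blast
      then have "\<beta> \<le> M (m i)" using M order_trans by blast
      ultimately show ?case using elim e(2)[of k x] x[of k i] i by linarith
    qed
  qed
qed

section \<open>Comparison with integrals against invariant measures\<close>

lemma integral_Avg:
  assumes \<nu>: "\<nu> \<in> inv_measures G T" and cont: "continuous_on UNIV f"
  shows "(\<integral>x. Avg T (F k) f x \<partial>\<nu>) = (\<integral>x. f x \<partial>\<nu>)"
proof -
  have sets: "sets \<nu> = sets borel" and "prob_space \<nu>"
    and inv: "\<And>g. g \<in> carrier G \<Longrightarrow> distr \<nu> borel (T g) = \<nu>"
    using \<nu> by (auto simp: inv_measures_def borel_prob_def)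
  interpret prob_space \<nu> by fact
  obtain b where b: "0 \<le> b" "\<And>x. \<bar>f x\<bar> \<le> b" using bounded_continuous_real[OF compact_space cont] by blast
  have f: "f \<in> borel_measurable borel" using cont by (rule borel_measurable_continuous_onI)
  have T: "T g \<in> measurable \<nu> borel" if "g \<in> carrier G" for g
    using borel_measurable_continuous_onI[OF continuous_T[OF that]]
    by (simp add: measurable_cong_sets[OF sets refl])
  have Tg: "g \<in> carrier G" if "g \<in> F k" for g using F_carrier that by blast
  have "integrable \<nu> (\<lambda>x. f (T g x))" if "g \<in> F k" for g
    using measurable_compose[OF T[OF Tg[OF that]] f] b(2) by (intro integrable_const_bound[of _ b]) auto
  then have "(\<integral>x. Avg T (F k) f x \<partial>\<nu>) = (\<Sum>g\<in>F k. \<integral>x. f (T g x) \<partial>\<nu>) / card (F k)"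
    by (simp add: Avg_def)
  also have "(\<Sum>g\<in>F k. \<integral>x. f (T g x) \<partial>\<nu>) = (\<Sum>g\<in>F k. \<integral>x. f x \<partial>\<nu>)"
    by (intro sum.cong refl) (metis Tg T f integral_distr inv)
  finally show ?thesis using card_F[of k] by simp
qed

text \<open>An invariant measure gives \<open>f\<close> and all its averages the same integral,
  which is therefore at most every maximum \<open>M n\<close> and so at most their infimum
  \<open>\<beta>\<close>. A point dominating \<open>\<beta>\<close> thus serves for
  \<open>upper_a\<close>.\<close>

lemma exists_upper_point:
  assumes temp: "tempered G F" and cont: "continuous_on UNIV f" and ne: "inv_measures G T \<noteq> {}"
  obtains x where "\<And>e. 0 < e \<Longrightarrow> \<forall>\<^sub>F k in sequentially. upper_a G T f - e < Avg T (F k) f x"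
proof -
  obtain b where b: "0 \<le> b" "\<And>x. \<bar>f x\<bar> \<le> b" using bounded_continuous_real[OF compact_space cont] by blast
  have "\<exists>y. \<forall>x. Avg T (F n) f x \<le> Avg T (F n) f y" for n
    using continuous_attains_sup[OF compact_space _ continuous_Avg[OF cont]] by auto
  then obtain y where y: "\<And>n x. Avg T (F n) f x \<le> Avg T (F n) f (y n)" by metis
  define M where "M n = Avg T (F n) f (y n)" for n
  define \<beta> where "\<beta> = (INF n. M n)"
  have bdd: "bdd_below (range M)"
  proof (rule bdd_belowI2)
    show "- b \<le> M n" for n
      using abs_Avg_le[where f = f, OF b(2), of n "y n"] unfolding M_def by linarith
  qed
  have "(\<integral>x. f x \<partial>\<nu>) \<le> \<beta>" if \<nu>: "\<nu> \<in> inv_measures G T" for \<nu>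
    unfolding \<beta>_def
  proof (rule cINF_greatest)
    fix n
    have sets: "sets \<nu> = sets borel" and "prob_space \<nu>"
      using \<nu> by (auto simp: inv_measures_def borel_prob_def)
    interpret prob_space \<nu> by fact
    have "Avg T (F n) f \<in> borel_measurable \<nu>"
      using borel_measurable_continuous_onI[OF continuous_Avg[OF cont]]
      by (simp add: measurable_cong_sets[OF sets refl])
    then have "integrable \<nu> (Avg T (F n) f)"
      using abs_Avg_le[where f = f, OF b(2)] by (intro integrable_const_bound[of _ b]) auto
    then have "(\<integral>x. Avg T (F n) f x \<partial>\<nu>) \<le> (\<integral>x. M n \<partial>\<nu>)"
      using y by (intro integral_mono) (auto simp: M_def)
    then show "(\<integral>x. f x \<partial>\<nu>) \<le> M n"
      using integral_Avg[OF \<nu> cont] by (simp add: prob_space)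
  qed simp
  then have up: "upper_a G T f \<le> \<beta>" unfolding upper_a_def by (rule cSUP_least[OF ne])
  obtain x where x: "\<And>e. 0 < e \<Longrightarrow> \<forall>\<^sub>F k in sequentially. \<beta> - e < Avg T (F k) f x"
  proof (rule exists_dominating_point[OF temp cont, of \<beta> M])
    show "\<exists>x. \<beta> \<le> Avg T (F n) f x" for n
      using cINF_lower[OF bdd, of n] by (auto simp: \<beta>_def M_def)
    show "\<exists>n. M n \<le> \<beta> + e" if "0 < e" for e
    proof -
      have "(INF n. M n) < \<beta> + e" using that by (simp add: \<beta>_def)
      then show ?thesis using cINF_less_iff[OF _ bdd] by (auto intro: less_imp_le)
    qed
  qed (use y in \<open>auto simp: M_def\<close>)
  show ?thesis
  proof
    fix e :: real assume "0 < e"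
    from x[OF this] show "\<forall>\<^sub>F k in sequentially. upper_a G T f - e < Avg T (F k) f x"
      by eventually_elim (use up in linarith)
  qed
qed

lemma exists_lower_point:
  assumes temp: "tempered G F" and cont: "continuous_on UNIV f" and ne: "inv_measures G T \<noteq> {}"
  obtains x where "\<And>e. 0 < e \<Longrightarrow> \<forall>\<^sub>F k in sequentially. Avg T (F k) f x < lower_a G T f + e"
proof -
  have "continuous_on UNIV (\<lambda>x. - f x)" by (intro continuous_intros cont)
  then obtain x where x: "\<And>e. 0 < e \<Longrightarrow>
      \<forall>\<^sub>F k in sequentially. upper_a G T (\<lambda>x. - f x) - e < Avg T (F k) (\<lambda>x. - f x) x"
    using exists_upper_point[OF temp _ ne] by blast
  \<comment> \<open>On the reals \<open>Inf\<close> is by definition the negative of the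
    \<open>Sup\<close> of the negatives.\<close>
  have eq: "upper_a G T (\<lambda>x. - f x) = - lower_a G T f"
    by (simp add: upper_a_def lower_a_def Inf_real_def image_image)
  show ?thesis
  proof
    fix e :: real assume "0 < e"
    from x[OF this] show "\<forall>\<^sub>F k in sequentially. Avg T (F k) f x < lower_a G T f + e"
      by eventually_elim (simp add: eq Avg_uminus)
  qed
qed

end

section \<open>Averages over unions of two balls\<close>

lemma LS_memI:
  fixes z :: "nat \<Rightarrow> 'b::metric_space"
  assumes "\<And>e N. 0 < e \<Longrightarrow> \<exists>k>N. dist (z k) l < e"
  shows "l \<in> LS z"
proof -
  have "\<exists>\<sigma>. \<forall>n. dist (z (\<sigma> n)) l < 1 / real (Suc n) \<and> \<sigma> n < \<sigma> (Suc n)"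
  proof (rule dependent_nat_choice)
    show "\<exists>k. dist (z k) l < 1 / real (Suc 0)" using assms[of 1 0] by auto
    show "\<exists>k'. dist (z k') l < 1 / real (Suc (Suc n)) \<and> k < k'" for k n
      using assms[of "1 / real (Suc (Suc n))" k] by auto
  qed
  then obtain \<sigma> where \<sigma>: "\<And>n. dist (z (\<sigma> n)) l < 1 / real (Suc n)" "\<And>n. \<sigma> n < \<sigma> (Suc n)" by blast
  have "(\<lambda>n. dist (z (\<sigma> n)) l) \<longlonglongrightarrow> 0"
  proof (rule Lim_null_comparison[OF _ LIMSEQ_inverse_real_of_nat])
    show "\<forall>\<^sub>F n in sequentially. norm (dist (z (\<sigma> n)) l) \<le> inverse (real (Suc n))"
      using \<sigma>(1) by (auto simp: inverse_eq_divide less_imp_le simp del: of_nat_Suc)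
  qed
  then have "(z \<circ> \<sigma>) \<longlonglongrightarrow> l"
    unfolding comp_def by (rule tendsto_dist_iff[THEN iffD2])
  moreover have "strict_mono \<sigma>" using \<sigma>(2) by (simp add: strict_mono_Suc_iff)
  ultimately show ?thesis by (auto simp: LS_def)
qed

lemma LS_cong:
  fixes z t :: "nat \<Rightarrow> real"
  assumes "(\<lambda>k. z k - t k) \<longlonglongrightarrow> 0"
  shows "LS z = LS t"
proof -
  have "(z \<circ> \<sigma>) \<longlonglongrightarrow> l \<longleftrightarrow> (t \<circ> \<sigma>) \<longlonglongrightarrow> l" if "strict_mono \<sigma>" for \<sigma> l
  proof -
    have lim: "((\<lambda>k. z k - t k) \<circ> \<sigma>) \<longlonglongrightarrow> 0" by (rule LIMSEQ_subseq_LIMSEQ[OF assms that])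
    show ?thesis
    proof
      assume "(z \<circ> \<sigma>) \<longlonglongrightarrow> l"
      from tendsto_diff[OF this lim] show "(t \<circ> \<sigma>) \<longlonglongrightarrow> l" by (simp add: comp_def)
    next
      assume "(t \<circ> \<sigma>) \<longlonglongrightarrow> l"
      from tendsto_add[OF this lim] show "(z \<circ> \<sigma>) \<longlonglongrightarrow> l" by (simp add: comp_def)
    qed
  qed
  then show ?thesis by (auto simp: LS_def)
qed

lemma exists_sequence_LS_eq:
  fixes K :: "'b::{metric_space, second_countable_topology} set"
  assumes "closed K" "K \<noteq> {}"
  obtains t where "\<And>k. t k \<in> K" "LS t = K"
proof -
  obtain D where D: "countable D" "D \<subseteq> K" "K \<subseteq> closure D" using separable .
  have Dne: "D \<noteq> {}" using D(3) assms(2) by auto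
  \<comment> \<open>Keeping only the first component of the decoded pair lists every element of
    \<open>D\<close> infinitely often; the free second component later pushes the index beyond any
    \<open>N\<close>.\<close>
  define t where "t k = from_nat_into D (fst (prod_decode k))" for k
  have tK: "t k \<in> K" for k using from_nat_into[OF Dne] D(2) by (auto simp: t_def)
  have "K \<subseteq> LS t"
  proof
    fix l assume "l \<in> K"
    show "l \<in> LS t"
    proof (rule LS_memI)
      fix e :: real and N assume "0 < e"
      then obtain d where d: "d \<in> D" "dist d l < e"
        using D(3) \<open>l \<in> K\<close> by (meson closure_approachable subsetD)
      then obtain i where i: "from_nat_into D i = d" using from_nat_into_surj[OF D(1)] by blast
      have "N < prod_encode (i, Suc N)" using le_prod_encode_2[of "Suc N" i] by simp
      moreover have "t (prod_encode (i, Suc N)) = d" by (simp add: t_def i)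
      ultimately show "\<exists>k>N. dist (t k) l < e" using d(2) by blast
    qed
  qed
  moreover have "LS t \<subseteq> K"
    using closed_sequentially[OF assms(1), of "t \<circ> \<sigma>" for \<sigma>] tK by (auto simp: LS_def)
  ultimately show ?thesis using that[of t] tK by blast
qed

section \<open>Dependence of spatial averages on the two radii\<close>

locale shell_neglecting =
  fixes \<mu> :: "'a::metric_space measure"
  assumes borel: "borel_prob \<mu>" and full: "fully_supported \<mu>" and shells: "neglects_shells \<mu>"
begin

sublocale prob_space \<mu> using borel by (simp add: borel_prob_def)

lemma sets_eq: "sets \<mu> = sets borel" using borel by (simp add: borel_prob_def)

lemma space_eq: "space \<mu> = UNIV" using sets_eq_imp_space_eq[OF sets_eq] by simp

lemma open_ball2: "open (ball2 x y r s)" by (simp add: ball2_def open_Un)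

lemma sets_ball2: "ball2 x y r s \<in> sets \<mu>" by (simp add: sets_eq borel_open open_ball2)

lemma measure_ball2_pos:
  assumes "0 < r \<or> 0 < s"
  shows "0 < measure \<mu> (ball2 x y r s)"
proof -
  have "x \<in> ball2 x y r s \<or> y \<in> ball2 x y r s" using assms by (auto simp: ball2_def)
  then have "ball2 x y r s \<noteq> {}" by blast
  then have "0 < emeasure \<mu> (ball2 x y r s)" using full open_ball2 unfolding fully_supported_def by blast
  then show ?thesis by (simp add: emeasure_eq_measure)
qed

lemma AE_not_on_shell:
  assumes "0 \<le> r"
  shows "AE z in \<mu>. dist x z \<noteq> r"
proof (rule AE_I[where N = "{z. dist x z = r}"])
  have "closed {z. dist x z = r}" by (intro closed_Collect_eq continuous_intros)
  then show "{z. dist x z = r} \<in> sets \<mu>" by (simp add: sets_eq)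
  show "emeasure \<mu> {z. dist x z = r} = 0" using shells assms by (simp add: neglects_shells_def)
  show "{z \<in> space \<mu>. \<not> dist x z \<noteq> r} \<subseteq> {z. dist x z = r}" by blast
qed

text \<open>Off the two limiting shells, which are null sets, membership in the balls is eventually
  constant, so dominated convergence applies. A limiting radius may be 0; its shell is then the
  centre alone.\<close>

lemma set_integral_ball2_tendsto:
  fixes h :: "'a \<Rightarrow> real"
  assumes r: "r \<longlonglongrightarrow> r0" "0 \<le> r0" and s: "s \<longlonglongrightarrow> s0" "0 \<le> s0"
    and h: "h \<in> borel_measurable borel" "\<And>z. \<bar>h z\<bar> \<le> b"
  shows "(\<lambda>n. LINT z:ball2 x y (r n) (s n)|\<mu>. h z) \<longlonglongrightarrow> (LINT z:ball2 x y r0 s0|\<mu>. h z)"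
  unfolding set_lebesgue_integral_def
proof (rule integral_dominated_convergence[where w = "\<lambda>_. b"])
  have [measurable]: "h \<in> borel_measurable \<mu>" using h(1) by (simp add: measurable_cong_sets[OF sets_eq refl])
  note [measurable] = sets_ball2
  show "(\<lambda>z. indicator (ball2 x y r0 s0) z *\<^sub>R h z) \<in> borel_measurable \<mu>" by measurable
  show "(\<lambda>z. indicator (ball2 x y (r n) (s n)) z *\<^sub>R h z) \<in> borel_measurable \<mu>" for n by measurable
  have b0: "0 \<le> b" using h(2)[of undefined] by linarith
  show "AE z in \<mu>. norm (indicator (ball2 x y (r n) (s n)) z *\<^sub>R h z) \<le> b" for n
    using h(2) b0 by (auto simp: indicator_def)
  have cmp: "\<forall>\<^sub>F n in sequentially. (d < q n) = (d < q0)" if "q \<longlonglongrightarrow> q0" "d \<noteq> q0"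
    for q :: "nat \<Rightarrow> real" and q0 d
  proof (cases "d < q0")
    case True
    then have "\<forall>\<^sub>F n in sequentially. d < q n" using that(1) by (rule order_tendstoD(1)[rotated])
    then show ?thesis by eventually_elim (use True in simp)
  next
    case False
    then have "\<forall>\<^sub>F n in sequentially. q n < d" using that by (intro order_tendstoD(2)) auto
    then show ?thesis by eventually_elim (use False in simp)
  qed
  show "AE z in \<mu>. (\<lambda>n. indicator (ball2 x y (r n) (s n)) z *\<^sub>R h z)
      \<longlonglongrightarrow> indicator (ball2 x y r0 s0) z *\<^sub>R h z"
    using AE_not_on_shell[OF r(2), of x] AE_not_on_shell[OF s(2), of y]
  proof eventually_elim
    case (elim z)
    from cmp[OF r(1) elim(1)] cmp[OF s(1) elim(2)]
    have "\<forall>\<^sub>F n in sequentially. indicator (ball2 x y (r n) (s n)) z *\<^sub>R h z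
        = indicator (ball2 x y r0 s0) z *\<^sub>R h z"
      by eventually_elim (simp add: ball2_def indicator_def)
    then show ?case by (rule tendsto_eventually)
  qed
qed simp

lemma measure_eq_set_integral: "E \<in> sets \<mu> \<Longrightarrow> measure \<mu> E = (LINT z:E|\<mu>. 1)"
  by (simp add: set_lebesgue_integral_def space_eq)

text \<open>The denominator is the integral of 1, so it converges like the numerator, and full
  support keeps its limit positive even if one limiting radius is 0.\<close>

lemma set_avg_ball2_tendsto:
  fixes h :: "'a \<Rightarrow> real"
  assumes r: "r \<longlonglongrightarrow> r0" "0 \<le> r0" and s: "s \<longlonglongrightarrow> s0" "0 \<le> s0" and pos: "0 < r0 \<or> 0 < s0"
    and h: "h \<in> borel_measurable borel" "\<And>z. \<bar>h z\<bar> \<le> b"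
  shows "(\<lambda>n. set_avg \<mu> (ball2 x y (r n) (s n)) h) \<longlonglongrightarrow> set_avg \<mu> (ball2 x y r0 s0) h"
  unfolding set_avg_def
proof (rule tendsto_divide)
  show "(\<lambda>n. measure \<mu> (ball2 x y (r n) (s n))) \<longlonglongrightarrow> measure \<mu> (ball2 x y r0 s0)"
    unfolding measure_eq_set_integral[OF sets_ball2]
    by (rule set_integral_ball2_tendsto[OF r s, where b = 1]) auto
  show "measure \<mu> (ball2 x y r0 s0) \<noteq> 0" using measure_ball2_pos[OF pos, of x y] by simp
qed (rule set_integral_ball2_tendsto[OF r s h])

lemma continuous_set_avg_ball2:
  fixes h :: "'a \<Rightarrow> real"
  assumes h: "h \<in> borel_measurable borel" "\<And>z. \<bar>h z\<bar> \<le> b"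
  shows "continuous_on ({0<..} \<times> {0<..}) (\<lambda>p. set_avg \<mu> (ball2 x y (fst p) (snd p)) h)"
  unfolding continuous_on_sequentially
proof (intro allI ballI impI)
  fix q :: "nat \<Rightarrow> real \<times> real" and p assume "p \<in> {0<..} \<times> {0<..}" "(\<forall>n. q n \<in> {0<..} \<times> {0<..}) \<and> q \<longlonglongrightarrow> p"
  then show "((\<lambda>p. set_avg \<mu> (ball2 x y (fst p) (snd p)) h) \<circ> q) \<longlonglongrightarrow> set_avg \<mu> (ball2 x y (fst p) (snd p)) h"
    unfolding comp_def
    by (intro set_avg_ball2_tendsto[where b = b] h tendsto_fst tendsto_snd) auto
qed

lemma set_avg_near:
  fixes h :: "'a \<Rightarrow> real"
  assumes E: "E \<in> sets \<mu>" "0 < measure \<mu> E" and h: "h \<in> borel_measurable borel" "\<And>z. \<bar>h z\<bar> \<le> b"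
    and near: "\<And>z. z \<in> E \<Longrightarrow> \<bar>h z - v\<bar> \<le> e"
  shows "\<bar>set_avg \<mu> E h - v\<bar> \<le> e"
proof -
  have [measurable]: "h \<in> borel_measurable \<mu>" using h(1) by (simp add: measurable_cong_sets[OF sets_eq refl])
  have "integrable \<mu> h" using h(2) by (intro integrable_const_bound[of _ b]) auto
  then have hi: "set_integrable \<mu> E h"
    unfolding set_integrable_def using E(1) by (rule integrable_mult_indicator[rotated])
  have ci: "set_integrable \<mu> E (\<lambda>_. a)" for a :: real
    unfolding set_integrable_def using E(1) by (intro integrable_mult_indicator) auto
  have const: "(LINT z:E|\<mu>. a) = measure \<mu> E * a" for a :: real
    using E(1) by (simp add: set_lebesgue_integral_def space_eq)
  have "measure \<mu> E * (v - e) \<le> (LINT z:E|\<mu>. h z)"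
    unfolding const[symmetric] using near by (intro set_integral_mono hi ci) (force simp: abs_le_iff)
  moreover have "(LINT z:E|\<mu>. h z) \<le> measure \<mu> E * (v + e)"
    unfolding const[symmetric] using near by (intro set_integral_mono hi ci) (force simp: abs_le_iff)
  ultimately show ?thesis
    using E(2) unfolding abs_le_iff set_avg_def by (simp add: field_simps)
qed

text \<open>Shrinking \<open>s\<close> to \<open>0\<close> with \<open>r\<close> fixed removes the second ball, since points are null sets.\<close>

lemma set_avg_ball2_near_left:
  fixes h :: "'a \<Rightarrow> real"
  assumes cont: "continuous_on UNIV h" and b: "\<And>z. \<bar>h z\<bar> \<le> b" and e: "0 < e"
  obtains r s where "0 < r" "0 < s" "\<bar>set_avg \<mu> (ball2 x y r s) h - h x\<bar> < e"
proof -
  have h: "h \<in> borel_measurable borel" using cont by (rule borel_measurable_continuous_onI)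
  obtain r where r: "0 < r" "\<And>z. dist z x < r \<Longrightarrow> dist (h z) (h x) < e / 2"
    using cont e unfolding continuous_on_iff by (metis UNIV_I half_gt_zero)
  have "\<bar>set_avg \<mu> (ball2 x y r 0) h - h x\<bar> \<le> e / 2"
  proof (rule set_avg_near[OF sets_ball2 measure_ball2_pos h b])
    fix z assume "z \<in> ball2 x y r 0"
    then have "dist z x < r" by (simp add: ball2_def dist_commute)
    from r(2)[OF this] show "\<bar>h z - h x\<bar> \<le> e / 2" by (simp add: dist_real_def)
  qed (simp add: r(1))
  \<comment> \<open>The oscillation of \<open>h\<close> on the first ball uses up half of
    \<open>e\<close>; the other half pays for giving the second ball a positive radius.\<close>
  moreover have "(\<lambda>n. set_avg \<mu> (ball2 x y r (inverse (real (Suc n)))) h) \<longlonglongrightarrow> set_avg \<mu> (ball2 x y r 0) h"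
    using r(1) by (intro set_avg_ball2_tendsto[OF _ _ LIMSEQ_inverse_real_of_nat _ _ h b]) auto
  then have "\<forall>\<^sub>F n in sequentially.
      dist (set_avg \<mu> (ball2 x y r (inverse (real (Suc n)))) h) (set_avg \<mu> (ball2 x y r 0) h) < e / 2"
    using e by (intro tendstoD) auto
  then obtain n where "dist (set_avg \<mu> (ball2 x y r (inverse (real (Suc n)))) h) (set_avg \<mu> (ball2 x y r 0) h) < e / 2"
    by (auto simp: eventually_sequentially)
  ultimately have "\<bar>set_avg \<mu> (ball2 x y r (inverse (real (Suc n)))) h - h x\<bar> < e"
    unfolding dist_real_def by linarith
  then show ?thesis using that[of r "inverse (real (Suc n))"] r(1) by simp
qed

lemma ball2_commute: "ball2 x y r s = ball2 y x s r"
  by (auto simp: ball2_def)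

text \<open>Averages concentrated at \<open>x\<close> and at \<open>y\<close> are joined through the
  connected quadrant of radii by the intermediate value theorem. Since \<open>t\<close> may lie
  slightly outside the range from \<open>h y\<close> to \<open>h x\<close>, the tolerance is
  \<open>2 * e\<close>.\<close>

lemma set_avg_ball2_approx:
  fixes h :: "'a \<Rightarrow> real"
  assumes cont: "continuous_on UNIV h" and b: "\<And>z. \<bar>h z\<bar> \<le> b" and e: "0 < e"
    and t: "t < h x + e" "h y - e < t"
  shows "\<exists>r s. 0 < r \<and> 0 < s \<and> \<bar>set_avg \<mu> (ball2 x y r s) h - t\<bar> < 2 * e"
proof -
  define \<alpha> where "\<alpha> p = set_avg \<mu> (ball2 x y (fst p) (snd p)) h" for p
  let ?Q = "{0<..} \<times> {0<..} :: (real \<times> real) set"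
  have h: "h \<in> borel_measurable borel" using cont by (rule borel_measurable_continuous_onI)
  obtain r s where "0 < r" "0 < s" "\<bar>set_avg \<mu> (ball2 x y r s) h - h x\<bar> < e"
    using set_avg_ball2_near_left[OF cont b e] by blast
  then have p: "(r, s) \<in> ?Q" "t - 2 * e < \<alpha> (r, s)" using t(1) by (auto simp: \<alpha>_def)
  obtain s' r' where "0 < s'" "0 < r'" "\<bar>set_avg \<mu> (ball2 y x s' r') h - h y\<bar> < e"
    using set_avg_ball2_near_left[OF cont b e] by blast
  then have q: "(r', s') \<in> ?Q" "\<alpha> (r', s') < t + 2 * e"
    using t(2) by (auto simp: \<alpha>_def ball2_commute[of x])
  have "connected (\<alpha> ` ?Q)"
    unfolding \<alpha>_def by (intro connected_continuous_image continuous_set_avg_ball2[OF h b] connected_Times) auto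
  then have "{\<alpha> (r', s')..\<alpha> (r, s)} \<subseteq> \<alpha> ` ?Q"
    by (rule connected_contains_Icc[OF _ imageI[OF q(1)] imageI[OF p(1)]])
  then have between: "t \<in> \<alpha> ` ?Q" if "\<alpha> (r', s') \<le> t \<and> t \<le> \<alpha> (r, s)"
    using that by auto
  have "\<exists>p\<in>?Q. \<bar>\<alpha> p - t\<bar> < 2 * e"
  proof (cases "\<alpha> (r', s') \<le> t \<and> t \<le> \<alpha> (r, s)")
    case True
    from between[OF this] obtain p where "p \<in> ?Q" "t = \<alpha> p" by blast
    then show ?thesis using e by (intro bexI[of _ p]) simp_all
  next
    case False
    \<comment> \<open>If the two averages do not enclose \<open>t\<close>, the one violating its
      inequality is itself within \<open>2 * e\<close> of \<open>t\<close>.\<close>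
    then consider "t < \<alpha> (r', s')" | "\<alpha> (r, s) < t" by linarith
    then show ?thesis
    proof cases
      case 1
      then show ?thesis using q e by (intro bexI[OF _ q(1)]) auto
    next
      case 2
      then show ?thesis using p e by (intro bexI[OF _ p(1)]) auto
    qed
  qed
  then show ?thesis by (auto simp: \<alpha>_def)
qed

end

section \<open>Steering the spatial averages along a dense sequence\<close>

theorem theorem4p7:
  fixes G :: "('g, 'm) monoid_scheme"
    and T :: "'g \<Rightarrow> 'a::metric_space \<Rightarrow> 'a"
    and F :: "nat \<Rightarrow> 'g set"
    and f :: "'a \<Rightarrow> real"
    and K :: "real set"
    and \<mu> :: "'a measure"
  assumes "compact (UNIV :: 'a set)"
    and "group G"
    and "homeo_action G T"
    and "amenable G"
    and "folner_seq G F"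
    and "tempered G F"
    and "continuous_on UNIV f"
    and "K \<noteq> {}" and "compact K" and "K \<subseteq> {lower_a G T f..upper_a G T f}"
    and "borel_prob \<mu>"
    and "fully_supported \<mu>"
    and "neglects_shells \<mu>"
  shows "\<exists>x y. \<exists>r s :: nat \<Rightarrow> real.
           (\<forall>k. r k > 0) \<and> (\<forall>k. s k > 0) \<and>
           K = LS (\<lambda>k. set_avg \<mu> (ball2 x y (r k) (s k)) (Avg T (F k) f))"
proof -
  note cpt = assms(1) and cont = assms(7)
  interpret folner_action G T F
    using assms(1,2,3,5) by (simp add: folner_action_def folner_action_axioms_def)
  interpret shell_neglecting \<mu> using assms(11,12,13) by unfold_locales
  \<comment> \<open>Amenability enters here: the extremal integrals range over a nonempty set of
    measures.\<close>
  have ne: "inv_measures G T \<noteq> {}" by (rule inv_measures_nonempty[OF assms(1,3,4)])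
  define a where "a = lower_a G T f"
  define A where "A = upper_a G T f"
  define h where "h k = Avg T (F k) f" for k
  obtain b where b: "0 \<le> b" "\<And>x. \<bar>f x\<bar> \<le> b" using bounded_continuous_real[OF cpt cont] by blast
  obtain x where x: "\<And>e. 0 < e \<Longrightarrow> \<forall>\<^sub>F k in sequentially. A - e < h k x"
    using exists_upper_point[OF assms(6) cont ne] unfolding A_def h_def by blast
  obtain y where y: "\<And>e. 0 < e \<Longrightarrow> \<forall>\<^sub>F k in sequentially. h k y < a + e"
    using exists_lower_point[OF assms(6) cont ne] unfolding a_def h_def by blast
  obtain t where t: "\<And>k. t k \<in> K" "LS t = K"
    using exists_sequence_LS_eq[OF compact_imp_closed[OF assms(9)] assms(8)] by blast
  \<comment> \<open>The shortfall of \<open>h k x\<close> below \<open>A\<close> and the excess of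
    \<open>h k y\<close> over \<open>a\<close>, clipped at 0. The added null sequence makes the
    tolerance strictly positive.\<close>
  define \<delta> where "\<delta> k = max 0 (max (A - h k x) (h k y - a)) + inverse (real (Suc k))" for k
  have "(\<lambda>k. max 0 (max (A - h k x) (h k y - a))) \<longlonglongrightarrow> 0"
  proof (rule LIMSEQ_I)
    fix e :: real assume e: "0 < e"
    have "\<forall>\<^sub>F k in sequentially. norm (max 0 (max (A - h k x) (h k y - a)) - 0) < e"
      using x[OF e] y[OF e] by eventually_elim (use e in auto)
    then show "\<exists>no. \<forall>k\<ge>no. norm (max 0 (max (A - h k x) (h k y - a)) - 0) < e"
      by (simp add: eventually_sequentially)
  qed
  then have "(\<lambda>k. 2 * \<delta> k) \<longlonglongrightarrow> 2 * (0 + 0)"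
    unfolding \<delta>_def by (intro tendsto_intros LIMSEQ_inverse_real_of_nat)
  then have \<delta>_lim: "(\<lambda>k. 2 * \<delta> k) \<longlonglongrightarrow> 0" by simp
  have "\<exists>r s. 0 < r \<and> 0 < s \<and> \<bar>set_avg \<mu> (ball2 x y r s) (h k) - t k\<bar> < 2 * \<delta> k" for k
  proof (rule set_avg_ball2_approx)
    have inv: "0 < inverse (real (Suc k))" by simp
    have "a \<le> t k" "t k \<le> A" using t(1)[of k] assms(10) by (auto simp: a_def A_def)
    moreover have "A - h k x < \<delta> k" "h k y - a < \<delta> k" using inv unfolding \<delta>_def by linarith+
    ultimately show "t k < h k x + \<delta> k" "h k y - \<delta> k < t k" by linarith+
    show "0 < \<delta> k" using inv unfolding \<delta>_def by linarith
    show "continuous_on UNIV (h k)" unfolding h_def by (rule continuous_Avg[OF cont])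
    show "\<bar>h k z\<bar> \<le> b" for z unfolding h_def by (rule abs_Avg_le[OF b(2)])
  qed
  then obtain r s where rs: "\<And>k. 0 < r k" "\<And>k. 0 < s k"
    "\<And>k. \<bar>set_avg \<mu> (ball2 x y (r k) (s k)) (h k) - t k\<bar> < 2 * \<delta> k"
    by metis
  have "(\<lambda>k. set_avg \<mu> (ball2 x y (r k) (s k)) (h k) - t k) \<longlonglongrightarrow> 0"
    by (rule Lim_null_comparison[OF _ \<delta>_lim]) (use rs(3) in \<open>auto intro!: always_eventually less_imp_le\<close>)
  then have "LS (\<lambda>k. set_avg \<mu> (ball2 x y (r k) (s k)) (h k)) = K"
    using LS_cong t(2) by metis
  then show ?thesis using rs(1,2) unfolding h_def by blast
qed

end
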